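(* Let $\mathsf{M}$ be a loopless matroid on $E=[n]$. A function $g:\Sigma_{\mathsf{M}}\to\mathbb{Z}$ is a Grothendieck weight on $\Sigma_{\mathsf{M}}$ if and only if for each pair $i\ne j$ in $E$ and each $\{i,j\}$-neutral flag of flats $\mathcal{G}$ of $\mathsf{M}$, $$\sum_{\mathcal{F}\in\mathbf{S}_{ij}(\mathcal{G})}(-1)^{\ell(\mathcal{F})}g(\mathcal{F})=\sum_{\mathcal{F}\in\mathbf{S}_{ji}(\mathcal{G})}(-1)^{\ell(\mathcal{F})}g(\mathcal{F}),$$ where $\mathbf{S}_{ij}(\mathcal{G})$ denotes the set of flags of flats $\mathcal{F}$ strictly refining $\mathcal{G}$ in which every new flat $H\in\mathcal{F}\setminus\mathcal{G}$ contains $i$ but not $j$.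
   Context: $[n]=\{1,\dots,n\}$. A flag of flats of $\mathsf{M}$ is a (possibly empty) chain $\mathcal{F}:\emptyset\subsetneq F_1\subsetneq\cdots\subsetneq F_k\subsetneq E$ of nonempty proper flats, also regarded as the set $\{F_1,\dots,F_k\}$; $\ell(\mathcal{F})=k$. The cones of the matroidal fan $\Sigma_{\mathsf{M}}$ are indexed by flags of flats, and $\Sigma_{\mathsf{M}}$ is identified with the set of flags of flats. $\mathcal{F}$ strictly refines $\mathcal{G}$ if $\mathcal{G}\subsetneq\mathcal{F}$ as sets of flats. $\mathcal{G}$ is $\{i,j\}$-neutral if every flat in $\mathcal{G}$ contains both $i$ and $j$ or neither. The matroid $K$-ring $K(\mathsf{M})$ is the commutative ring generated by symbols $x_F$, $F$ a nonempty proper flat, subject to: $x_Fx_G=0$ if $F,G$ are incomparable; and $\prod_{F\not\ni i}(1-x_F)=\prod_{F\not\ni j}(1-x_F)$ for all $i,j\in E$. For a flag of flats $\mathcal{F}=\{F_1\subsetneq\cdots\subsetneq F_k\}$ put $x_{\mathcal{F}}=x_{F_1}\cdots x_{F_k}$, $x_\emptyset=1$. A Grothendieck weight on $\Sigma_{\mathsf{M}}$ is a function $g:\Sigma_{\mathsf{M}}\to\mathbb{Z}$ such that $\sum_{\mathcal{F}}c_{\mathcal{F}}g(\mathcal{F})=0$ for every integral relation $\sum_{\mathcal{F}}c_{\mathcal{F}}x_{\mathcal{F}}=0$ in $K(\mathsf{M})$. *)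

theory Defs
  imports "HOL-Library.Poly_Mapping" "HOL-Algebra.QuotRing"
begin

section \<open>Matroids, flats and flags of flats\<close>

locale matroid =
  fixes E :: "'a set" and indep :: "'a set \<Rightarrow> bool"
  assumes finite_ground: "finite E"
    and indep_subset_ground: "indep X \<Longrightarrow> X \<subseteq> E"
    and indep_empty: "indep {}"
    and indep_mono: "indep Y \<Longrightarrow> X \<subseteq> Y \<Longrightarrow> indep X"
    and augmentation:
      "indep X \<Longrightarrow> indep Y \<Longrightarrow> card X < card Y \<Longrightarrow> \<exists>e\<in>Y - X. indep (insert e X)"

locale loopless_matroid = matroid +
  assumes loopless: "e \<in> E \<Longrightarrow> indep {e}"

definition mrank :: "('a set \<Rightarrow> bool) \<Rightarrow> 'a set \<Rightarrow> nat" where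
  "mrank indep X = Max (card ` {I. I \<subseteq> X \<and> indep I})"

definition flat :: "'a set \<Rightarrow> ('a set \<Rightarrow> bool) \<Rightarrow> 'a set \<Rightarrow> bool" where
  "flat E indep F \<longleftrightarrow>
     F \<subseteq> E \<and> (\<forall>e\<in>E - F. mrank indep F < mrank indep (insert e F))"

definition proper_flats :: "'a set \<Rightarrow> ('a set \<Rightarrow> bool) \<Rightarrow> 'a set set" where
  "proper_flats E indep = {F. flat E indep F \<and> F \<noteq> {} \<and> F \<noteq> E}"

text \<open>A flag is the set of its flats; this also serves as the matroidal fan, whose cones
  are indexed by the flags. The number of flats in a flag is its cardinality.\<close>

definition flags :: "'a set \<Rightarrow> ('a set \<Rightarrow> bool) \<Rightarrow> 'a set set set" where
  "flags E indep = {\<F>. subset.chain (proper_flats E indep) \<F>}"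

definition neutral :: "'a \<Rightarrow> 'a \<Rightarrow> 'a set set \<Rightarrow> bool" where
  "neutral i j \<G> \<longleftrightarrow> (\<forall>G\<in>\<G>. i \<in> G \<longleftrightarrow> j \<in> G)"

definition refinements ::
    "'a set \<Rightarrow> ('a set \<Rightarrow> bool) \<Rightarrow> 'a \<Rightarrow> 'a \<Rightarrow> 'a set set \<Rightarrow> 'a set set set" where
  "refinements E indep i j \<G> =
     {\<F> \<in> flags E indep. \<G> \<subset> \<F> \<and> (\<forall>H\<in>\<F> - \<G>. i \<in> H \<and> j \<notin> H)}"

section \<open>The matroid K-ring\<close>

text \<open>Integer polynomials in variables indexed by sets, as finitely supported coefficient
  functions on exponent vectors.\<close>

type_synonym 'a set_mpoly = "('a set \<Rightarrow>\<^sub>0 nat) \<Rightarrow>\<^sub>0 int"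

definition flat_var :: "'a set \<Rightarrow> 'a set_mpoly" where
  "flat_var F = Poly_Mapping.single (Poly_Mapping.single F 1) 1"

text \<open>The polynomial ring whose variables are exactly the nonempty proper flats.\<close>

definition flat_poly_ring :: "'a set \<Rightarrow> ('a set \<Rightarrow> bool) \<Rightarrow> 'a set_mpoly ring" where
  "flat_poly_ring E indep =
     \<lparr>carrier = {p. \<forall>m\<in>Poly_Mapping.keys p. Poly_Mapping.keys m \<subseteq> proper_flats E indep},
      mult = (*), one = 1, zero = 0, add = (+)\<rparr>"

lemma cring_flat_poly_ring: "cring (flat_poly_ring E indep)"
proof -
  let ?P = "proper_flats E indep"
  let ?C = "{p :: 'a set_mpoly. \<forall>m\<in>Poly_Mapping.keys p. Poly_Mapping.keys m \<subseteq> ?P}"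
  have add_closed: "p + q \<in> ?C" if "p \<in> ?C" "q \<in> ?C" for p q
    using that Poly_Mapping.keys_add[of p q] by blast
  have uminus_closed: "- p \<in> ?C" if "p \<in> ?C" for p
    using that by simp
  have mult_closed: "p * q \<in> ?C" if p: "p \<in> ?C" and q: "q \<in> ?C" for p q
  proof (rule CollectI, rule ballI)
    fix m assume "m \<in> Poly_Mapping.keys (p * q)"
    then obtain a b where "a \<in> Poly_Mapping.keys p" "b \<in> Poly_Mapping.keys q" "m = a + b"
      using Poly_Mapping.keys_mult[of p q] by blast
    then show "Poly_Mapping.keys m \<subseteq> ?P"
      using p q Poly_Mapping.keys_add[of a b] by blast
  qed
  have R: "carrier (flat_poly_ring E indep) = ?C"
      "mult (flat_poly_ring E indep) = (*)" "one (flat_poly_ring E indep) = 1"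
      "zero (flat_poly_ring E indep) = 0" "add (flat_poly_ring E indep) = (+)"
    by (simp_all add: flat_poly_ring_def)
  have "abelian_group (flat_poly_ring E indep)"
  proof (rule abelian_groupI, unfold R)
    fix p assume "p \<in> ?C"
    then show "\<exists>q\<in>?C. q + p = 0"
      using uminus_closed by (intro bexI[of _ "- p"]) simp_all
  qed (rule add_closed add.assoc add.commute | assumption | simp)+
  moreover have "comm_monoid (flat_poly_ring E indep)"
    by (rule comm_monoidI, unfold R)
      (rule mult_closed mult.assoc mult.commute | assumption | simp)+
  ultimately show ?thesis
    by (rule cringI) (simp only: R distrib_right)
qed

text \<open>Each relation \<open>p = q\<close> in the presentation is recorded as the polynomial \<open>p - q\<close>.\<close>

definition K_relations :: "'a set \<Rightarrow> ('a set \<Rightarrow> bool) \<Rightarrow> 'a set_mpoly set" where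
  "K_relations E indep =
     {flat_var F * flat_var G | F G.
        F \<in> proper_flats E indep \<and> G \<in> proper_flats E indep \<and> \<not> F \<subseteq> G \<and> \<not> G \<subseteq> F} \<union>
     {(\<Prod>F\<in>{F \<in> proper_flats E indep. i \<notin> F}. 1 - flat_var F) -
      (\<Prod>F\<in>{F \<in> proper_flats E indep. j \<notin> F}. 1 - flat_var F) | i j. i \<in> E \<and> j \<in> E}"

definition K_ideal :: "'a set \<Rightarrow> ('a set \<Rightarrow> bool) \<Rightarrow> 'a set_mpoly set" where
  "K_ideal E indep = genideal (flat_poly_ring E indep) (K_relations E indep)"

definition K_ring :: "'a set \<Rightarrow> ('a set \<Rightarrow> bool) \<Rightarrow> 'a set_mpoly set ring" where
  "K_ring E indep = flat_poly_ring E indep Quot K_ideal E indep"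

definition K_gen :: "'a set \<Rightarrow> ('a set \<Rightarrow> bool) \<Rightarrow> 'a set \<Rightarrow> 'a set_mpoly set" where
  "K_gen E indep F = K_ideal E indep +>\<^bsub>flat_poly_ring E indep\<^esub> flat_var F"

definition K_flag :: "'a set \<Rightarrow> ('a set \<Rightarrow> bool) \<Rightarrow> 'a set set \<Rightarrow> 'a set_mpoly set" where
  "K_flag E indep \<F> = (\<Otimes>\<^bsub>K_ring E indep\<^esub>F\<in>\<F>. K_gen E indep F)"

text \<open>A function on the fan is represented by a total function, of which only the values at
  flags matter.\<close>

definition grothendieck_weight ::
    "'a set \<Rightarrow> ('a set \<Rightarrow> bool) \<Rightarrow> ('a set set \<Rightarrow> int) \<Rightarrow> bool" where
  "grothendieck_weight E indep g \<longleftrightarrow>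
     (\<forall>c :: 'a set set \<Rightarrow> int.
        (\<Oplus>\<^bsub>K_ring E indep\<^esub>\<F>\<in>flags E indep. [c \<F>] \<cdot>\<^bsub>K_ring E indep\<^esub> K_flag E indep \<F>)
          = \<zero>\<^bsub>K_ring E indep\<^esub>
        \<longrightarrow> (\<Sum>\<F>\<in>flags E indep. c \<F> * g \<F>) = 0)"

end

theory Submission
  imports Defs
begin

text \<open>
  Put \<open>y\<^sub>F = 1 - x\<^sub>F\<close> and \<open>P\<^sub>i = \<Prod> y\<^sub>F\<close> over the flats \<open>F\<close> avoiding \<open>i\<close>.

  Necessity. Let \<open>\<G>\<close> be \<open>{i,j}\<close>-neutral. The factors common to \<open>P\<^sub>i\<close> and \<open>P\<^sub>j\<close> can be cancelled
  from \<open>x\<^sub>\<G> (P\<^sub>i - P\<^sub>j) = 0\<close>, and the products that remain expand into the sums over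
  \<open>S\<^sub>j\<^sub>i(\<G>)\<close> and \<open>S\<^sub>i\<^sub>j(\<G>)\<close>.

  Sufficiency. A linear form \<open>\<phi>\<close> on the \<open>K\<close>-ring with \<open>\<phi>(x\<^sub>\<F>) = g(\<F>)\<close> is constructed through the
  functions \<open>h \<F> a = \<phi>(x\<^sub>\<F> y\<^sup>a)\<close> of an exponent vector \<open>a\<close> with integer entries. They satisfy
  \<open>h \<F> a - h \<F> (a + F) = h (\<F> \<union> {F}) a\<close> and are periodic under the differences of the exponent
  vectors of \<open>P\<^sub>i\<close> and \<open>P\<^sub>j\<close>. By downward induction on \<open>\<F>\<close>, a function \<open>h \<F>\<close> exists: the differences
  in the directions outside \<open>\<F>\<close> can be integrated, the periods surject onto the coordinates in \<open>\<F>\<close>,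
  and the two prescriptions agree because of the equations for \<open>g\<close>.
\<close>

section \<open>Flags\<close>

context matroid
begin

abbreviation "\<P> \<equiv> proper_flats E indep"
abbreviation "\<L> \<equiv> flags E indep"

lemma proper_flat_subset: "F \<in> \<P> \<Longrightarrow> F \<subset> E"
  by (auto simp: proper_flats_def flat_def)

lemma proper_flat_nonempty: "F \<in> \<P> \<Longrightarrow> F \<noteq> {}"
  by (simp add: proper_flats_def)

lemma finite_proper_flats: "finite \<P>"
  by (rule finite_subset[of _ "Pow E"]) (use finite_ground proper_flat_subset in auto)

lemma flag_subset: "\<F> \<in> \<L> \<Longrightarrow> \<F> \<subseteq> \<P>"
  by (simp add: flags_def subset_chain_def)

lemma flag_comparable: "\<F> \<in> \<L> \<Longrightarrow> F \<in> \<F> \<Longrightarrow> G \<in> \<F> \<Longrightarrow> F \<subseteq> G \<or> G \<subseteq> F"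
  by (simp add: flags_def subset_chain_def)

lemma finite_flag: "\<F> \<in> \<L> \<Longrightarrow> finite \<F>"
  using finite_proper_flats finite_subset flag_subset by blast

lemma finite_flags: "finite \<L>"
  by (rule finite_subset[of _ "Pow \<P>"]) (use finite_proper_flats flag_subset in auto)

lemma insert_flag:
  "insert F \<F> \<in> \<L> \<longleftrightarrow> F \<in> \<P> \<and> (\<forall>G\<in>\<F>. G \<subseteq> F \<or> F \<subseteq> G) \<and> \<F> \<in> \<L>"
  by (simp add: flags_def subset_chain_insert)

text \<open>Choose j in F outside the largest member strictly below F, and i outside F in the
  smallest member strictly above F, with the empty set and E as substitutes where no such member
  exists. All other members are comparable with F, so none of them separates i from j.\<close>

lemma flag_separation:
  assumes \<F>: "\<F> \<in> \<L>" and F: "F \<in> \<F>"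
  obtains i j where "i \<in> E - F" "j \<in> F" "neutral i j (\<F> - {F})"
proof -
  let ?lower = "{G \<in> \<F>. G \<subset> F}" and ?upper = "{G \<in> \<F>. F \<subset> G}"
  have fin: "finite ?lower" "finite ?upper"
    using finite_flag[OF \<F>] by auto
  have chains: "subset.chain \<P> ?lower" "subset.chain \<P> ?upper"
    using \<F> by (auto simp: flags_def subset_chain_def)
  have FP: "F \<in> \<P>"
    using \<F> F flag_subset by blast
  have "\<exists>j\<in>F. \<forall>G\<in>?lower. j \<notin> G"
  proof (cases "?lower = {}")
    case True
    then show ?thesis using proper_flat_nonempty[OF FP] by blast
  next
    case False
    then have "\<Union>?lower \<in> ?lower"
      by (rule Union_in_chain[OF fin(1) _ chains(1)])
    then obtain j where "j \<in> F" "j \<notin> \<Union>?lower" by blast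
    then show ?thesis by blast
  qed
  then obtain j where j: "j \<in> F" "\<And>G. G \<in> ?lower \<Longrightarrow> j \<notin> G" by blast
  have "\<exists>i\<in>E - F. \<forall>G\<in>?upper. i \<in> G"
  proof (cases "?upper = {}")
    case True
    then show ?thesis using proper_flat_subset[OF FP] by blast
  next
    case False
    define U where "U = \<Inter>?upper"
    from False have "U \<in> ?upper"
      unfolding U_def by (rule Inter_in_chain[OF fin(2) _ chains(2)])
    then have "F \<subset> U" "U \<subset> E"
      using flag_subset[OF \<F>] proper_flat_subset[of U] by (simp, blast)
    then obtain i where i: "i \<in> U" "i \<in> E - F"
      by blast
    from i(1) have "\<forall>G\<in>?upper. i \<in> G" by (simp only: U_def Inter_iff)
    with i(2) show ?thesis by (rule bexI[rotated])
  qed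
  then obtain i where i: "i \<in> E - F" "\<And>G. G \<in> ?upper \<Longrightarrow> i \<in> G" by blast
  have "neutral i j (\<F> - {F})"
    unfolding neutral_def
  proof
    fix G assume G: "G \<in> \<F> - {F}"
    then have "G \<in> ?lower \<or> G \<in> ?upper"
      using flag_comparable[OF \<F> F, of G] by blast
    then show "i \<in> G \<longleftrightarrow> j \<in> G"
      using i j by blast
  qed
  with i(1) j(1) show thesis by (rule that)
qed

text \<open>These flats index the factors of \<open>P\<^sub>j\<close> that do not occur in
  \<open>P\<^sub>i\<close>.\<close>

definition separating_flats :: "'a \<Rightarrow> 'a \<Rightarrow> 'a set set" where
  "separating_flats i j = {F \<in> \<P>. i \<in> F \<and> j \<notin> F}"

lemma finite_separating_flats: "finite (separating_flats i j)"
  unfolding separating_flats_def using finite_proper_flats by simp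

lemma neutral_disjoint: "neutral i j \<G> \<Longrightarrow> separating_flats i j \<inter> \<G> = {}"
  by (auto simp: neutral_def separating_flats_def)

lemma neutral_sym: "neutral i j \<G> \<longleftrightarrow> neutral j i \<G>"
  by (auto simp: neutral_def)

text \<open>The refinements are the flags \<G> \<union> \<T> with \<T> a nonempty set of separating
  flats; \<T> = {} contributes the term f \<G>. Neutrality makes \<T> disjoint from \<G>, which
  accounts for the sign. The values of f lie in an arbitrary commutative ring, so that the identity
  serves both for integer weights and for flag monomials.\<close>

lemma sum_subsets_eq_refinements:
  fixes f :: "'a set set \<Rightarrow> 'b::comm_ring_1"
  assumes \<G>: "\<G> \<in> \<L>" and neutral: "neutral i j \<G>"
    and zero: "\<And>\<F>. \<F> \<notin> \<L> \<Longrightarrow> f \<F> = 0"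
  shows "(\<Sum>\<T>\<in>Pow (separating_flats i j). (-1) ^ card \<T> * f (\<G> \<union> \<T>)) =
    f \<G> + (-1) ^ card \<G> * (\<Sum>\<F>\<in>refinements E indep i j \<G>. (-1) ^ card \<F> * f \<F>)"
proof -
  let ?S = "separating_flats i j"
  let ?T = "{\<T> \<in> Pow ?S. \<G> \<union> \<T> \<in> \<L> \<and> \<T> \<noteq> {}}"
  have finS: "finite ?S" by (rule finite_separating_flats)
  have disj: "\<G> \<inter> \<T> = {}" if "\<T> \<subseteq> ?S" for \<T>
    using neutral_disjoint[OF neutral] that by blast
  have "(\<Sum>\<T>\<in>Pow ?S. (-1) ^ card \<T> * f (\<G> \<union> \<T>)) =
      (\<Sum>\<T>\<in>insert {} ?T. (-1) ^ card \<T> * f (\<G> \<union> \<T>))"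
  proof (rule sum.mono_neutral_right)
    show "\<forall>\<T>\<in>Pow ?S - insert {} ?T. (-1) ^ card \<T> * f (\<G> \<union> \<T>) = 0"
    proof
      fix \<T> assume "\<T> \<in> Pow ?S - insert {} ?T"
      then have "\<G> \<union> \<T> \<notin> \<L>" by blast
      then show "(-1) ^ card \<T> * f (\<G> \<union> \<T>) = 0" by (simp add: zero)
    qed
  qed (use finS in auto)
  also have "\<dots> = f \<G> + (\<Sum>\<T>\<in>?T. (-1) ^ card \<T> * f (\<G> \<union> \<T>))"
    using finS by (subst sum.insert) auto
  also have "(\<Sum>\<T>\<in>?T. (-1) ^ card \<T> * f (\<G> \<union> \<T>)) =
      (\<Sum>\<F>\<in>refinements E indep i j \<G>. (-1) ^ card \<G> * ((-1) ^ card \<F> * f \<F>))"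
  proof (rule sum.reindex_bij_witness[of _ "\<lambda>\<F>. \<F> - \<G>" "\<lambda>\<T>. \<G> \<union> \<T>"])
    fix \<T> assume \<T>: "\<T> \<in> ?T"
    then show "\<G> \<union> \<T> - \<G> = \<T>" using disj by blast
    show "\<G> \<union> \<T> \<in> refinements E indep i j \<G>"
      using \<T> disj[of \<T>] by (auto simp: refinements_def separating_flats_def)
    have "card (\<G> \<union> \<T>) = card \<G> + card \<T>"
      using \<T> disj[of \<T>] finite_flag[OF \<G>] finite_subset[OF _ finS]
      by (intro card_Un_disjoint) auto
    then show "(-1) ^ card \<G> * ((-1) ^ card (\<G> \<union> \<T>) * f (\<G> \<union> \<T>)) = (-1) ^ card \<T> * f (\<G> \<union> \<T>)"
      by (simp add: power_add flip: mult.assoc power_mult_distrib)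
  next
    fix \<F> assume \<F>: "\<F> \<in> refinements E indep i j \<G>"
    then show "\<G> \<union> (\<F> - \<G>) = \<F>" by (auto simp: refinements_def)
    then show "\<F> - \<G> \<in> ?T"
      using \<F> flag_subset[of \<F>] by (auto simp: refinements_def separating_flats_def)
  qed
  finally show ?thesis by (simp add: sum_distrib_left)
qed

end

section \<open>Difference equations on a lattice\<close>

lemma int_antidifference:
  fixes f :: "int \<Rightarrow> int"
  shows "\<exists>u. \<forall>k. u k - u (k + 1) = f k"
proof (intro exI allI)
  fix k :: int
  \<comment> \<open>Signed partial sums from 0: at most one of the two intervals is
    nonempty.\<close>
  let ?u = "\<lambda>k::int. sum f {k..<0} - sum f {0..<k}"
  show "?u k - ?u (k + 1) = f k"
  proof (cases "k \<ge> 0")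
    case True
    then have "{0..<k + 1} = insert k {0..<k}" by auto
    with True show ?thesis by simp
  next
    case False
    then have "{k..<0} = insert k {k + 1..<0}" by auto
    with False show ?thesis by simp
  qed
qed

text \<open>D is integrated along each line in direction x, starting from the point with
  x-coordinate 0. The antidifference depends only on the restriction of D to the line, so invariance
  of D under another direction passes to u.\<close>

lemma antidifference:
  fixes D :: "('b \<Rightarrow>\<^sub>0 int) \<Rightarrow> int"
  obtains u where "\<And>a. u a - u (a + frag_of x) = D a"
    and "\<And>y a. y \<noteq> x \<Longrightarrow> (\<And>a. D (a + frag_of y) = D a) \<Longrightarrow> u (a + frag_of y) = u a"
proof -
  have "\<forall>f :: int \<Rightarrow> int. \<exists>u. \<forall>k. u k - u (k + 1) = f k"
    using int_antidifference by blast
  then obtain I :: "(int \<Rightarrow> int) \<Rightarrow> int \<Rightarrow> int" where I: "\<And>f k. I f k - I f (k + 1) = f k"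
    by metis
  define proj where "proj a = a - frag_cmul (Poly_Mapping.lookup a x) (frag_of x)" for a :: "'b \<Rightarrow>\<^sub>0 int"
  define f where "f a k = D (proj a + frag_cmul k (frag_of x))" for a k
  define u where "u a = I (f a) (Poly_Mapping.lookup a x)" for a
  have proj_x: "proj (a + frag_of x) = proj a" for a
  proof -
    have "Poly_Mapping.lookup (a + frag_of x) x = Poly_Mapping.lookup a x + 1" by (simp add: lookup_add)
    then show ?thesis by (simp add: proj_def frag_cmul_distrib)
  qed
  have "u a - u (a + frag_of x) = D a" for a
  proof -
    have "f (a + frag_of x) = f a" by (simp add: f_def fun_eq_iff proj_x)
    then have "u a - u (a + frag_of x) = f a (Poly_Mapping.lookup a x)"
      by (simp add: u_def I lookup_add)
    then show ?thesis by (simp add: f_def proj_def)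
  qed
  moreover have "u (a + frag_of y) = u a"
    if y: "y \<noteq> x" and D: "\<And>a. D (a + frag_of y) = D a" for y a
  proof -
    have "proj (a + frag_of y) = proj a + frag_of y"
      using y by (simp add: proj_def lookup_add)
    then have "f (a + frag_of y) = f a"
      using D[of "proj a + frag_cmul k (frag_of x)" for k]
      by (simp add: f_def fun_eq_iff ac_simps)
    then show ?thesis using y by (simp add: u_def lookup_add)
  qed
  ultimately show thesis by (rule that) blast+
qed

text \<open>A discrete Poincare lemma. Directions in S are treated one at a time by subtracting the
  differences of an antidifference v of \<open>D s\<close>. If \<open>D x\<close> is already zero,
  compatibility makes \<open>D s\<close> invariant under x, hence v as well, so directions already
  cleared stay cleared.\<close>

lemma antidifference_system:
  fixes D :: "'b \<Rightarrow> ('b \<Rightarrow>\<^sub>0 int) \<Rightarrow> int"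
  assumes "finite S" "S \<subseteq> W"
    and "\<And>x a. x \<in> W - S \<Longrightarrow> D x a = 0"
    and "\<And>x y a. x \<in> W \<Longrightarrow> y \<in> W \<Longrightarrow>
      D x a - D x (a + frag_of y) = D y a - D y (a + frag_of x)"
  shows "\<exists>u. \<forall>x\<in>W. \<forall>a. u a - u (a + frag_of x) = D x a"
  using assms
proof (induction S arbitrary: D rule: finite_induct)
  case empty
  then show ?case by (intro exI[of _ "\<lambda>_. 0"]) auto
next
  case (insert s S)
  obtain v where v: "\<And>a. v a - v (a + frag_of s) = D s a"
    and v_inv: "\<And>y a. y \<noteq> s \<Longrightarrow> (\<And>a. D s (a + frag_of y) = D s a) \<Longrightarrow> v (a + frag_of y) = v a"
    by (rule antidifference[of s "D s"]) blast
  define D' where "D' x a = D x a - (v a - v (a + frag_of x))" for x a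
  have "\<exists>u. \<forall>x\<in>W. \<forall>a. u a - u (a + frag_of x) = D' x a"
  proof (rule insert.IH)
    show "S \<subseteq> W" using insert.prems(1) by blast
    show "D' x a = 0" if x: "x \<in> W - S" for x a
    proof (cases "x = s")
      case True
      then show ?thesis by (simp add: D'_def v)
    next
      case False
      then have D0: "D x a = 0" for a using insert.prems(2) x by blast
      have "D s (a + frag_of x) = D s a" for a
        using insert.prems(3)[of s x a] insert.prems(1) x by (simp add: D0)
      then show ?thesis using v_inv[OF False] by (simp add: D'_def D0)
    qed
    show "D' x a - D' x (a + frag_of y) = D' y a - D' y (a + frag_of x)"
      if "x \<in> W" "y \<in> W" for x y a
      using insert.prems(3)[OF that, of a] by (simp add: D'_def ac_simps)
  qed
  then obtain u where u: "\<And>x a. x \<in> W \<Longrightarrow> u a - u (a + frag_of x) = D' x a" by blast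
  have "(u a + v a) - (u (a + frag_of x) + v (a + frag_of x)) = D x a" if "x \<in> W" for x a
    using u[OF that, of a] by (simp add: D'_def)
  then show ?case by (intro exI[of _ "\<lambda>a. u a + v a"]) blast
qed

text \<open>Each unit shift by x replaces h Y by h Y - h (insert x Y); iterating over A is the
  expansion of a product of factors \<open>1 - x\<^sub>F\<close>.\<close>

lemma sum_over_subsets_of_shift:
  fixes h :: "'b set \<Rightarrow> ('b \<Rightarrow>\<^sub>0 int) \<Rightarrow> int"
  assumes h: "\<And>Y x a. finite Y \<Longrightarrow> X \<subseteq> Y \<Longrightarrow> x \<notin> Y \<Longrightarrow> h Y a - h Y (a + frag_of x) = h (insert x Y) a"
    and "finite X" "finite A" "A \<inter> X = {}"
  shows "h X (a + (\<Sum>x\<in>A. frag_of x)) = (\<Sum>T\<in>Pow A. (-1) ^ card T * h (X \<union> T) a)"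
  using assms(3,4)
proof (induction A arbitrary: a rule: finite_induct)
  case (insert x A)
  have inj: "inj_on (insert x) (Pow A)"
    using insert.hyps(2) by (auto intro!: inj_onI)
  have "h X (a + (\<Sum>x\<in>insert x A. frag_of x)) = h X ((a + frag_of x) + (\<Sum>x\<in>A. frag_of x))"
    using insert.hyps by (simp add: ac_simps)
  also have "\<dots> = (\<Sum>T\<in>Pow A. (-1) ^ card T * h (X \<union> T) (a + frag_of x))"
    using insert.IH insert.prems by blast
  also have "\<dots> = (\<Sum>T\<in>Pow A. (-1) ^ card T * h (X \<union> T) a + (-1) ^ card (insert x T) * h (X \<union> insert x T) a)"
  proof (rule sum.cong[OF refl])
    fix T assume T: "T \<in> Pow A"
    then have fin: "finite T" using insert.hyps(1) finite_subset by blast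
    have "h (X \<union> T) (a + frag_of x) = h (X \<union> T) a - h (insert x (X \<union> T)) a"
    proof -
      have "x \<notin> X \<union> T" using T insert.hyps(2) insert.prems by blast
      then show ?thesis using h[of "X \<union> T" x a] fin \<open>finite X\<close> by simp
    qed
    moreover have "card (insert x T) = Suc (card T)"
      using T fin insert.hyps(2) by (intro card_insert_disjoint) auto
    ultimately show "(-1) ^ card T * h (X \<union> T) (a + frag_of x) =
        (-1) ^ card T * h (X \<union> T) a + (-1) ^ card (insert x T) * h (X \<union> insert x T) a"
      by (simp only:) (simp add: algebra_simps)
  qed
  also have "\<dots> = (\<Sum>T\<in>Pow A. (-1) ^ card T * h (X \<union> T) a) +
      (\<Sum>T\<in>insert x ` Pow A. (-1) ^ card T * h (X \<union> T) a)"
    by (simp add: sum.distrib sum.reindex[OF inj])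
  also have "\<dots> = (\<Sum>T\<in>Pow (insert x A). (-1) ^ card T * h (X \<union> T) a)"
    unfolding Pow_insert
    by (rule sum.union_disjoint[symmetric]) (use insert.hyps in auto)
  finally show ?case .
qed simp

text \<open>The periods of e form a subgroup, which contains the image under f of every generator in
  S and hence f b.\<close>

lemma frag_invariant:
  fixes f :: "('b \<Rightarrow>\<^sub>0 int) \<Rightarrow> 'c::ab_group_add"
  assumes "Poly_Mapping.keys b \<subseteq> S"
    and e: "\<And>x a. x \<in> S \<Longrightarrow> e (a + f (frag_of x)) = e a"
    and f: "\<And>a b. f (a - b) = f a - f b"
  shows "e (a + f b) = e a"
proof -
  have "\<forall>a. e (a + f b) = e a"
    using assms(1)
  proof (induction b rule: frag_induction)
    case zero
    have "f 0 = 0" using f[of 0 0] by (metis diff_self)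
    then show ?case by simp
  next
    case (diff b c)
    show ?case
    proof
      fix a
      have "e (a + f (b - c)) = e ((a - f c) + f b)" by (simp add: f algebra_simps)
      also have "\<dots> = e ((a - f c) + f c)" using diff by metis
      finally show "e (a + f (b - c)) = e a" by simp
    qed
  qed (use e in blast)
  then show ?thesis by blast
qed

section \<open>Period vectors and the coherent family of a balanced function\<close>

context matroid
begin

definition avoiding_sum :: "'a \<Rightarrow> 'a set \<Rightarrow>\<^sub>0 int" where
  "avoiding_sum i = (\<Sum>F\<in>{F \<in> \<P>. i \<notin> F}. frag_of F)"

lemma lookup_avoiding_sum:
  "Poly_Mapping.lookup (avoiding_sum i) F = (if F \<in> \<P> \<and> i \<notin> F then 1 else 0)"
  by (simp add: avoiding_sum_def lookup_sum finite_proper_flats)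

lemma lookup_sum_separating_flats:
  "Poly_Mapping.lookup (\<Sum>F\<in>separating_flats i j. frag_of F) F =
     (if F \<in> \<P> \<and> i \<in> F \<and> j \<notin> F then 1 else 0)"
  by (simp add: lookup_sum finite_separating_flats) (simp add: separating_flats_def)

text \<open>Both sides are the indicator vector of the proper flats that do not contain both i and
  j.\<close>

lemma avoiding_sum_swap:
  "avoiding_sum i + (\<Sum>F\<in>separating_flats i j. frag_of F) =
   avoiding_sum j + (\<Sum>F\<in>separating_flats j i. frag_of F)"
proof (rule poly_mapping_eqI)
  fix F
  show "Poly_Mapping.lookup (avoiding_sum i + (\<Sum>F\<in>separating_flats i j. frag_of F)) F =
      Poly_Mapping.lookup (avoiding_sum j + (\<Sum>F\<in>separating_flats j i. frag_of F)) F"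
    unfolding lookup_add lookup_avoiding_sum lookup_sum_separating_flats
    by (cases "i \<in> F"; cases "j \<in> F") simp_all
qed

text \<open>The difference \<open>\<Delta> i - \<Delta> j\<close> is what remains of a period after its coordinates in \<open>\<F>\<close> have
  been cleared; it is a combination of neutral periods.\<close>

lemma neutral_span:
  fixes p q :: "'a set \<Rightarrow> 'a" and \<F> :: "'a set set"
  defines "\<Delta> i \<equiv> avoiding_sum i - (\<Sum>F\<in>{F \<in> \<F>. i \<notin> F}. avoiding_sum (p F) - avoiding_sum (q F))"
  assumes \<F>: "\<F> \<in> \<L>"
    and p: "\<And>F. F \<in> \<F> \<Longrightarrow> p F \<in> E - F" and q: "\<And>F. F \<in> \<F> \<Longrightarrow> q F \<in> F"
    and pq: "\<And>F. F \<in> \<F> \<Longrightarrow> neutral (p F) (q F) (\<F> - {F})"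
    and zero: "Q 0" and diff: "\<And>x y. Q x \<Longrightarrow> Q y \<Longrightarrow> Q (x - y)"
    and neutral: "\<And>i j. i \<in> E \<Longrightarrow> j \<in> E \<Longrightarrow> neutral i j \<F> \<Longrightarrow> Q (avoiding_sum i - avoiding_sum j)"
    and ij: "i \<in> E" "j \<in> E"
  shows "Q (\<Delta> i - \<Delta> j)"
proof -
  have plus: "Q (x + y)" if "Q x" "Q y" for x y
    using diff[OF that(1) diff[OF zero that(2)]] by simp
  have neutral_\<Delta>: "Q (\<Delta> i - \<Delta> j)" if "i \<in> E" "j \<in> E" "neutral i j \<F>" for i j
  proof -
    have "{F \<in> \<F>. i \<notin> F} = {F \<in> \<F>. j \<notin> F}"
      using that(3) by (auto simp: neutral_def)
    then have "\<Delta> i - \<Delta> j = avoiding_sum i - avoiding_sum j" by (simp add: \<Delta>_def)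
    then show ?thesis using neutral[OF that] by simp
  qed
  \<comment> \<open>Modulo Q, every element of E is moved into all members of \<F>, which the
    induction achieves by lowering the number of members that avoid it.\<close>
  have reduce: "\<exists>z\<in>E. {F \<in> \<F>. z \<notin> F} = {} \<and> Q (\<Delta> i - \<Delta> z)" if "i \<in> E" for i
    using that
  proof (induction "card {F \<in> \<F>. i \<notin> F}" arbitrary: i rule: less_induct)
    case less
    let ?X = "{F \<in> \<F>. i \<notin> F}"
    have fin: "finite ?X" using finite_flag[OF \<F>] by simp
    show ?case
    proof (cases "?X = {}")
      case True
      then show ?thesis using less.prems zero by (intro bexI[of _ i]) auto
    next
      case False
      \<comment> \<open>The largest member avoiding i. The elements i and \<open>p F\<close> lie in
        the same members of \<F>, while \<open>q F\<close> lies in F in addition.\<close>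
      define F where "F = \<Union>?X"
      have chain: "subset.chain \<P> ?X"
        using \<F> by (auto simp: flags_def subset_chain_def)
      have FX: "F \<in> ?X"
        unfolding F_def by (rule Union_in_chain[OF fin False chain])
      then have F: "F \<in> \<F>" and iF: "i \<notin> F" by simp_all
      have FE: "F \<subseteq> E" using F \<F> flag_subset proper_flat_subset by blast
      have pF: "p F \<in> E" "p F \<notin> F" and qF: "q F \<in> E" "q F \<in> F"
        using p[OF F] q[OF F] FE by blast+
      have same: "p F \<in> G \<longleftrightarrow> q F \<in> G" if "G \<in> \<F>" "G \<noteq> F" for G
        using pq[OF F] that by (simp add: neutral_def)
      have i_p: "i \<in> G \<longleftrightarrow> p F \<in> G" if G: "G \<in> \<F>" for G
      proof (cases "i \<in> G")
        case True
        then have "F \<subseteq> G" "G \<noteq> F" using flag_comparable[OF \<F> F G] iF by blast+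
        then show ?thesis using True same[OF G] qF(2) by blast
      next
        case False
        then have "G \<subseteq> F" unfolding F_def using G by blast
        then show ?thesis using False pF(2) by blast
      qed
      then have neut: "neutral i (p F) \<F>" by (simp add: neutral_def)
      have Xp: "{G \<in> \<F>. p F \<notin> G} = insert F {G \<in> \<F>. q F \<notin> G}"
        using same F pF(2) by auto
      have notin: "F \<notin> {G \<in> \<F>. q F \<notin> G}" using qF(2) by simp
      have fin': "finite {G \<in> \<F>. q F \<notin> G}" using finite_flag[OF \<F>] by simp
      have Xi: "?X = {G \<in> \<F>. p F \<notin> G}" using i_p by blast
      have "card {G \<in> \<F>. q F \<notin> G} < card ?X"
        unfolding Xi Xp by (simp add: card_insert_disjoint[OF fin' notin])
      then obtain z where z: "z \<in> E" "{F \<in> \<F>. z \<notin> F} = {}" "Q (\<Delta> (q F) - \<Delta> z)"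
        using less.hyps[of "q F"] qF(1) by blast
      \<comment> \<open>The sum subtracted in \<open>\<Delta> (p F)\<close> has one term more, the
        one for F, which is exactly \<open>avoiding_sum (p F) - avoiding_sum (q F)\<close>.\<close>
      have "\<Delta> (p F) = \<Delta> (q F)"
        unfolding \<Delta>_def Xp sum.insert[OF fin' notin] by (simp add: algebra_simps)
      then have "\<Delta> i - \<Delta> z = (\<Delta> i - \<Delta> (p F)) + (\<Delta> (q F) - \<Delta> z)" by simp
      then have "Q (\<Delta> i - \<Delta> z)"
        using plus[OF neutral_\<Delta>[OF less.prems pF(1) neut] z(3)] by simp
      then show ?thesis using z by blast
    qed
  qed
  obtain z where z: "z \<in> E" "{F \<in> \<F>. z \<notin> F} = {}" "Q (\<Delta> i - \<Delta> z)"
    using reduce[OF ij(1)] by blast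
  obtain w where w: "w \<in> E" "{F \<in> \<F>. w \<notin> F} = {}" "Q (\<Delta> j - \<Delta> w)"
    using reduce[OF ij(2)] by blast
  have "neutral z w \<F>" using z(2) w(2) by (auto simp: neutral_def)
  then have "Q ((\<Delta> i - \<Delta> z) + (\<Delta> z - \<Delta> w) - (\<Delta> j - \<Delta> w))"
    by (intro diff[OF plus[OF z(3) neutral_\<Delta>[OF z(1) w(1)]] w(3)])
  then show ?thesis by simp
qed

definition balanced :: "('a set set \<Rightarrow> int) \<Rightarrow> bool" where
  "balanced g \<longleftrightarrow> (\<forall>i\<in>E. \<forall>j\<in>E. \<forall>\<G>\<in>\<L>. neutral i j \<G> \<longrightarrow>
     (\<Sum>\<F>\<in>refinements E indep i j \<G>. (-1) ^ card \<F> * g \<F>) =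
     (\<Sum>\<F>\<in>refinements E indep j i \<G>. (-1) ^ card \<F> * g \<F>))"

text \<open>The conditions on \<open>r = h \<F>\<close>, given \<open>h\<close> at the larger sets of flats. Setting \<open>h\<close> to zero off
  the flags encodes the relations \<open>x\<^sub>F x\<^sub>G = 0\<close>.\<close>

definition coherent ::
    "('a set set \<Rightarrow> int) \<Rightarrow> ('a set set \<Rightarrow> ('a set \<Rightarrow>\<^sub>0 int) \<Rightarrow> int) \<Rightarrow> 'a set set \<Rightarrow>
      (('a set \<Rightarrow>\<^sub>0 int) \<Rightarrow> int) \<Rightarrow> bool" where
  "coherent g h \<F> r \<longleftrightarrow>
     (\<F> \<notin> \<L> \<longrightarrow> r = (\<lambda>_. 0)) \<and>
     (\<F> \<in> \<L> \<longrightarrow> r 0 = g \<F> \<and>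
       (\<forall>F a. F \<notin> \<F> \<longrightarrow> r a - r (a + frag_of F) = h (insert F \<F>) a) \<and>
       (\<forall>i\<in>E. \<forall>j\<in>E. \<forall>a. r (a + avoiding_sum i) = r (a + avoiding_sum j)))"

lemma coherent_at_zero: "coherent g h \<F> r \<Longrightarrow> r 0 = (if \<F> \<in> \<L> then g \<F> else 0)"
  by (cases "\<F> \<in> \<L>") (simp_all only: coherent_def if_True if_False simp_thms)

lemma coherent_zero: "coherent g h \<F> r \<Longrightarrow> \<F> \<notin> \<L> \<Longrightarrow> r a = 0"
  by (simp add: coherent_def)

lemma coherent_step:
  assumes "coherent g h \<G> (h \<G>)" "coherent g h (insert F \<G>) (h (insert F \<G>))" "F \<notin> \<G>"
  shows "h \<G> a - h \<G> (a + frag_of F) = h (insert F \<G>) a"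
proof (cases "\<G> \<in> \<L>")
  case True
  then show ?thesis using assms(1,3) unfolding coherent_def by blast
next
  case False
  then have "insert F \<G> \<notin> \<L>" by (simp add: insert_flag)
  then show ?thesis
    using coherent_zero[OF assms(1) False] coherent_zero[OF assms(2)] by simp
qed

lemma coherent_periodic:
  assumes "coherent g h \<G> r" "i \<in> E" "j \<in> E"
  shows "r (a + avoiding_sum i) = r (a + avoiding_sum j)"
proof (cases "\<G> \<in> \<L>")
  case True
  then show ?thesis using assms unfolding coherent_def by blast
next
  case False
  then show ?thesis using coherent_zero[OF assms(1)] by simp
qed

text \<open>A solution u of the difference equations outside \<F> is only trusted on vectors whose
  coordinates in \<F> vanish. Any a is brought there by subtracting a period \<open>s a\<close>, and
  r is defined as u (a - s a). Balance of g ensures that u has the periods which this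
  requires.\<close>

lemma coherent_extension:
  assumes bal: "balanced g" and \<F>: "\<F> \<in> \<L>"
    and coh: "\<And>\<G>. finite \<G> \<Longrightarrow> \<F> \<subset> \<G> \<Longrightarrow> coherent g h \<G> (h \<G>)"
  shows "\<exists>r. coherent g h \<F> r"
proof -
  have zero: "h \<G> a = 0" if "finite \<G>" "\<F> \<subset> \<G>" "\<G> \<notin> \<L>" for \<G> a
    using coherent_zero[OF coh] that by blast
  have step: "h \<G> a - h \<G> (a + frag_of F) = h (insert F \<G>) a"
    if "finite \<G>" "\<F> \<subset> \<G>" "F \<notin> \<G>" for \<G> F a
    using that coh by (intro coherent_step) auto
  have periodic': "h \<G> (a + (avoiding_sum i - avoiding_sum j)) = h \<G> a"
    if "finite \<G>" "\<F> \<subset> \<G>" "i \<in> E" "j \<in> E" for \<G> a i j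
    using coherent_periodic[OF coh[OF that(1,2)] that(3,4), of "a - avoiding_sum j"]
    by (simp add: algebra_simps)
  have fin: "finite \<F>" by (rule finite_flag[OF \<F>])
  have ins: "finite (insert F \<F>)" "\<F> \<subset> insert F \<F>" if "F \<notin> \<F>" for F
    using fin that by auto

  \<comment> \<open>Compatibility holds because for F \<noteq> G both mixed differences equal the
    value of h at \<F> \<union> {F, G}.\<close>
  have "\<exists>u. \<forall>F\<in>-\<F>. \<forall>a. u a - u (a + frag_of F) = h (insert F \<F>) a"
  proof (rule antidifference_system[of "\<P> - \<F>"])
    show "h (insert F \<F>) a = 0" if "F \<in> - \<F> - (\<P> - \<F>)" for F a
      using that zero[OF ins] by (auto simp: insert_flag)
    show "h (insert F \<F>) a - h (insert F \<F>) (a + frag_of G) =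
        h (insert G \<F>) a - h (insert G \<F>) (a + frag_of F)"
      if "F \<in> - \<F>" "G \<in> - \<F>" for F G a
    proof (cases "F = G")
      case False
      then show ?thesis
        using that step[OF ins, of F G a] step[OF ins, of G F a] by (simp add: insert_commute)
    qed simp
  qed (use finite_proper_flats in auto)
  then obtain u0 where u0: "\<And>F a. F \<notin> \<F> \<Longrightarrow> u0 a - u0 (a + frag_of F) = h (insert F \<F>) a"
    by blast
  define u where "u a = u0 a - u0 0 + g \<F>" for a
  have u: "u a - u (a + frag_of F) = h (insert F \<F>) a" if "F \<notin> \<F>" for F a
    using u0[OF that, of a] by (simp add: u_def)

  define vanishing where "vanishing a \<longleftrightarrow> (\<forall>G\<in>\<F>. Poly_Mapping.lookup a G = 0)" for a :: "'a set \<Rightarrow>\<^sub>0 int"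
  \<comment> \<open>The periods of the restriction of u to vanishing vectors; how u depends on the
    coordinates in \<F> has not been controlled.\<close>
  define Q where "Q \<kappa> \<longleftrightarrow> vanishing \<kappa> \<and> (\<forall>b. vanishing b \<longrightarrow> u (b + \<kappa>) = u b)" for \<kappa>
  have Q0: "Q 0" by (simp add: Q_def vanishing_def)
  have Qdiff: "Q (x - y)" if "Q x" "Q y" for x y
    unfolding Q_def
  proof (intro conjI allI impI)
    show "vanishing (x - y)" using that by (simp add: Q_def vanishing_def lookup_minus)
    fix b assume "vanishing b"
    then have "vanishing (b - y)" using that by (simp add: Q_def vanishing_def lookup_minus)
    then have "u ((b - y) + x) = u (b - y)" "u ((b - y) + y) = u (b - y)"
      using that unfolding Q_def by blast+
    then show "u (b + (x - y)) = u b" by (simp add: algebra_simps)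
  qed
  have Qneutral: "Q (avoiding_sum i - avoiding_sum j)"
    if i: "i \<in> E" and j: "j \<in> E" and neutral: "neutral i j \<F>" for i j
  proof -
    let ?\<kappa> = "avoiding_sum i - avoiding_sum j"
    let ?S = "\<lambda>i j. \<Sum>F\<in>separating_flats i j. frag_of F"
    \<comment> \<open>The failure of ?\<kappa> to be a period. It is constant on vanishing vectors,
      since h at the larger flags is periodic, so it suffices to find one vanishing b with e b =
      0.\<close>
    define e where "e b = u (b + ?\<kappa>) - u b" for b
    have e_step: "e (b + frag_of F) = e b" if "F \<in> -\<F>" for F b
    proof -
      have "h (insert F \<F>) (b + ?\<kappa>) = h (insert F \<F>) b"
        using periodic'[OF ins i j] that by simp
      then show ?thesis
        using u[of F b] u[of F "b + ?\<kappa>"] that by (simp add: e_def algebra_simps)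
    qed
    have e_const: "e b = e 0" if "vanishing b" for b
    proof -
      have "Poly_Mapping.keys b \<subseteq> -\<F>"
        using that by (auto simp: vanishing_def in_keys_iff)
      then show ?thesis
        using frag_invariant[of b "-\<F>" e "\<lambda>x. x" 0] e_step by simp
    qed
    \<comment> \<open>With u inserted at \<F>, the family h' obeys the step rule on all finite sets
      containing \<F>, and its values at 0 are those of g'. Shifting 0 by \<open>?S i j\<close>
      therefore produces the sum over refinements.\<close>
    define g' where "g' \<G> = (if \<G> \<in> \<L> then g \<G> else 0)" for \<G>
    define h' where "h' = h(\<F> := u)"
    have h'_step: "h' \<G> a - h' \<G> (a + frag_of F) = h' (insert F \<G>) a"
      if \<G>: "finite \<G>" "\<F> \<subseteq> \<G>" "F \<notin> \<G>" for \<G> F a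
      using \<G> u[of F a] step[of \<G> F a] by (auto simp: h'_def)
    have h'_0: "h' \<G> 0 = g' \<G>" if "finite \<G>" "\<F> \<subseteq> \<G>" for \<G>
    proof (cases "\<G> = \<F>")
      case True
      then show ?thesis using \<F> by (simp add: h'_def g'_def u_def)
    next
      case False
      then have "coherent g h \<G> (h \<G>)" using that coh by blast
      then have "h \<G> 0 = g' \<G>"
        by (simp only: coherent_at_zero g'_def)
      then show ?thesis using False by (simp add: h'_def)
    qed
    have u_S: "u (?S i j) = g \<F> + (-1) ^ card \<F> *
        (\<Sum>\<G>\<in>refinements E indep i j \<F>. (-1) ^ card \<G> * g \<G>)"
      if neutral: "neutral i j \<F>" for i j
    proof -
      have "u (?S i j) = h' \<F> (0 + ?S i j)" by (simp add: h'_def)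
      also have "\<dots> = (\<Sum>\<T>\<in>Pow (separating_flats i j). (-1) ^ card \<T> * h' (\<F> \<union> \<T>) 0)"
        using fin finite_separating_flats neutral_disjoint[OF neutral] h'_step
        by (intro sum_over_subsets_of_shift) auto
      also have "\<dots> = (\<Sum>\<T>\<in>Pow (separating_flats i j). (-1) ^ card \<T> * g' (\<F> \<union> \<T>))"
        using h'_0 fin finite_subset[OF _ finite_separating_flats] by (intro sum.cong) auto
      also have "\<dots> = g' \<F> + (-1) ^ card \<F> *
          (\<Sum>\<G>\<in>refinements E indep i j \<F>. (-1) ^ card \<G> * g' \<G>)"
        by (rule sum_subsets_eq_refinements[OF \<F> neutral]) (simp add: g'_def)
      also have "(\<Sum>\<G>\<in>refinements E indep i j \<F>. (-1) ^ card \<G> * g' \<G>) =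
          (\<Sum>\<G>\<in>refinements E indep i j \<F>. (-1) ^ card \<G> * g \<G>)"
        by (intro sum.cong) (auto simp: g'_def refinements_def)
      finally show ?thesis using \<F> by (simp add: g'_def)
    qed
    \<comment> \<open>Here the balance equation enters; as ?\<kappa> carries the first vector to the
      second, e vanishes at \<open>?S i j\<close>.\<close>
    have "u (?S i j) = u (?S j i)"
      using u_S[OF neutral] u_S[of j i] neutral bal i j \<F> neutral_sym[of i j]
      by (simp add: balanced_def)
    moreover have "?S i j + ?\<kappa> = ?S j i"
      using avoiding_sum_swap[of i j] by (simp add: algebra_simps)
    ultimately have "e (?S i j) = 0" by (simp add: e_def)
    moreover have "vanishing (?S i j)"
      unfolding vanishing_def lookup_sum_separating_flats using neutral by (simp add: neutral_def)
    ultimately have "e b = 0" if "vanishing b" for b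
      using e_const that by metis
    moreover have "vanishing ?\<kappa>"
      using neutral by (auto simp: vanishing_def lookup_minus lookup_avoiding_sum neutral_def)
    ultimately show ?thesis by (simp add: Q_def e_def)
  qed

  have "\<forall>F\<in>\<F>. \<exists>ij. fst ij \<in> E - F \<and> snd ij \<in> F \<and> neutral (fst ij) (snd ij) (\<F> - {F})"
    using flag_separation[OF \<F>] by (metis fst_conv snd_conv)
  then obtain pq where pq: "\<And>F. F \<in> \<F> \<Longrightarrow>
      fst (pq F) \<in> E - F \<and> snd (pq F) \<in> F \<and> neutral (fst (pq F)) (snd (pq F)) (\<F> - {F})"
    by metis
  define p where "p F = fst (pq F)" for F
  define q where "q F = snd (pq F)" for F
  have p: "p F \<in> E - F" and q: "q F \<in> F" and neutral_pq: "neutral (p F) (q F) (\<F> - {F})"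
    if "F \<in> \<F>" for F
    using pq[OF that] by (simp_all add: p_def q_def)
  have qE: "q F \<in> E" if "F \<in> \<F>" for F
    using q[OF that] that \<F> flag_subset proper_flat_subset by blast
  \<comment> \<open>On the coordinates in \<F>, these periods restrict to the standard basis:
    \<open>p F\<close> and \<open>q F\<close> are separated by F and by no other member of
    \<F>.\<close>
  define lam where "lam F = (if F \<in> \<F> then avoiding_sum (p F) - avoiding_sum (q F) else 0)" for F
  \<comment> \<open>\<open>s a\<close> is a period with the same coordinates in \<open>\<F>\<close> as \<open>a\<close>\<close>
  define s where "s = frag_extend lam"
  have s_diff: "s (a - b) = s a - s b" and s_add: "s (a + b) = s a + s b" for a b
    by (simp_all add: s_def frag_extend_diff frag_extend_add)
  have s_of: "s (frag_of F) = lam F" for F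
    by (simp add: s_def)
  have lookup_lam: "Poly_Mapping.lookup (lam F) G = (if F = G then 1 else 0)" if G: "G \<in> \<F>" for F G
  proof (cases "F \<in> \<F>")
    case True
    have "G \<in> \<P>" using G \<F> flag_subset by blast
    then show ?thesis
      using True G p[OF True] q[OF True] neutral_pq[OF True]
      by (auto simp: lam_def lookup_minus lookup_avoiding_sum neutral_def)
  qed (use G in \<open>auto simp: lam_def\<close>)
  have lookup_s: "Poly_Mapping.lookup (s a) G = Poly_Mapping.lookup a G" if G: "G \<in> \<F>" for a G
    using subset_UNIV[of "Poly_Mapping.keys a"]
    by (induction a rule: frag_induction)
      (auto simp: s_of s_diff lookup_minus lookup_lam[OF G], simp add: s_def)
  then have vanishing_s: "vanishing (a - s a)" for a
    by (simp add: vanishing_def lookup_minus)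
  have h_s: "h \<G> (b - s a) = h \<G> b" if \<G>: "finite \<G>" "\<F> \<subset> \<G>" for \<G> a b
  proof -
    have "h \<G> ((b - s a) + s a) = h \<G> (b - s a)"
    proof (rule frag_invariant[where S = UNIV and e = "h \<G>" and f = s])
      show "h \<G> (c + s (frag_of F)) = h \<G> c" for F c
        using periodic'[OF \<G>] p qE by (simp add: s_of lam_def)
    qed (simp_all add: s_diff)
    then show ?thesis by simp
  qed
  have s_avoiding_sum: "s (avoiding_sum i) =
      (\<Sum>F\<in>{F \<in> \<F>. i \<notin> F}. avoiding_sum (p F) - avoiding_sum (q F))" for i
  proof -
    have "s (avoiding_sum i) = (\<Sum>F\<in>{F \<in> \<P>. i \<notin> F}. lam F)"
      unfolding avoiding_sum_def s_def
      by (subst frag_extend_sum) (simp_all add: finite_proper_flats o_def)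
    also have "\<dots> = (\<Sum>F\<in>{F \<in> \<F>. i \<notin> F}. lam F)"
      using flag_subset[OF \<F>] finite_proper_flats
      by (intro sum.mono_neutral_right) (auto simp: lam_def)
    finally show ?thesis by (simp add: lam_def)
  qed

  have "coherent g h \<F> (\<lambda>a. u (a - s a))"
    unfolding coherent_def
  proof (intro conjI allI impI ballI)
    show "u (0 - s 0) = g \<F>" by (simp add: s_def u_def)
  next
    fix F a assume F: "F \<notin> \<F>"
    then have "s (a + frag_of F) = s a" by (simp add: s_add s_of lam_def)
    then have "u (a - s a) - u (a + frag_of F - s (a + frag_of F)) = h (insert F \<F>) (a - s a)"
      using u[OF F, of "a - s a"] by (simp add: algebra_simps)
    then show "u (a - s a) - u (a + frag_of F - s (a + frag_of F)) = h (insert F \<F>) a"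
      using h_s[OF ins[OF F]] by simp
  next
    fix i j a assume ij: "i \<in> E" "j \<in> E"
    \<comment> \<open>By additivity of s, this is the difference of the arguments of u in the
      required periodicity.\<close>
    have "Q ((avoiding_sum i - s (avoiding_sum i)) - (avoiding_sum j - s (avoiding_sum j)))"
      unfolding s_avoiding_sum
      using \<F> p q neutral_pq Q0 Qdiff Qneutral ij by (rule neutral_span)
    then have "u ((a + avoiding_sum j - s (a + avoiding_sum j)) +
        ((avoiding_sum i - s (avoiding_sum i)) - (avoiding_sum j - s (avoiding_sum j)))) =
        u (a + avoiding_sum j - s (a + avoiding_sum j))"
      using vanishing_s unfolding Q_def by blast
    then show "u (a + avoiding_sum i - s (a + avoiding_sum i)) = u (a + avoiding_sum j - s (a + avoiding_sum j))"
      by (simp add: s_add algebra_simps)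
  qed (use \<F> in simp)
  then show ?thesis by blast
qed

text \<open>Coherence at \<F> refers to h only at sets with one more flat, so h is chosen by
  well-founded recursion from large flags down.\<close>

lemma ex_coherent:
  assumes "balanced g"
  shows "\<exists>h. \<forall>\<F>. coherent g h \<F> (h \<F>)"
proof (rule dependent_wf_choice[of "{(\<G>, \<F>). \<F> \<in> \<L> \<and> finite \<G> \<and> \<F> \<subset> \<G>}"])
  let ?R = "{(\<G>, \<F>). \<F> \<in> \<L> \<and> finite \<G> \<and> \<F> \<subset> \<G>}"
  \<comment> \<open>\<G> may be any finite set, even one with more than \<open>card \<P>\<close>
    elements; \<open>Suc\<close> keeps the measure of the flag \<F> positive, so that it still drops
    strictly.\<close>
  have "?R \<subseteq> measure (\<lambda>\<F>. Suc (card \<P>) - card \<F>)"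
  proof
    fix x assume "x \<in> ?R"
    then obtain \<G> \<F> where x: "x = (\<G>, \<F>)" "\<F> \<in> \<L>" "finite \<G>" "\<F> \<subset> \<G>" by blast
    then have "card \<F> < card \<G>" by (intro psubset_card_mono)
    moreover have "card \<F> \<le> card \<P>"
      using x(2) flag_subset finite_proper_flats by (intro card_mono)
    ultimately show "x \<in> measure (\<lambda>\<F>. Suc (card \<P>) - card \<F>)" by (simp add: x(1))
  qed
  then show "wf ?R" by (rule wf_subset[OF wf_measure])
next
  fix h h' :: "'a set set \<Rightarrow> ('a set \<Rightarrow>\<^sub>0 int) \<Rightarrow> int" and \<F> r
  assume eq: "\<And>\<G>. (\<G>, \<F>) \<in> {(\<G>, \<F>). \<F> \<in> \<L> \<and> finite \<G> \<and> \<F> \<subset> \<G>} \<Longrightarrow> h \<G> = h' \<G>"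
  have "h (insert F \<F>) = h' (insert F \<F>)" if "\<F> \<in> \<L>" "F \<notin> \<F>" for F
    using eq[of "insert F \<F>"] that finite_flag by auto
  then show "coherent g h \<F> r = coherent g h' \<F> r"
    by (simp add: coherent_def)
next
  fix \<F> h
  assume coh: "\<And>\<G>. (\<G>, \<F>) \<in> {(\<G>, \<F>). \<F> \<in> \<L> \<and> finite \<G> \<and> \<F> \<subset> \<G>} \<Longrightarrow> coherent g h \<G> (h \<G>)"
  show "\<exists>r. coherent g h \<F> r"
  proof (cases "\<F> \<in> \<L>")
    case True
    then show ?thesis using coh by (intro coherent_extension[OF assms]) auto
  qed (simp add: coherent_def)
qed

end

section \<open>Relations among flag monomials\<close>

context matroid
begin

section \<open>Polynomial representatives and the ideal of relations\<close>

abbreviation "R \<equiv> flat_poly_ring E indep"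
abbreviation "I \<equiv> K_ideal E indep"
abbreviation "K \<equiv> K_ring E indep"

lemma R_simps [simp]:
  "mult R = (*)" "one R = 1" "zero R = 0" "add R = (+)"
  by (simp_all add: flat_poly_ring_def)

lemma carrier_R: "carrier R = {p. \<forall>m\<in>Poly_Mapping.keys p. Poly_Mapping.keys m \<subseteq> \<P>}"
  by (simp add: flat_poly_ring_def)

sublocale R: cring R
  by (rule cring_flat_poly_ring)

lemma carrier_uminus: "p \<in> carrier R \<Longrightarrow> - p \<in> carrier R"
  by (simp add: carrier_R)

lemma carrier_add: "p \<in> carrier R \<Longrightarrow> q \<in> carrier R \<Longrightarrow> p + q \<in> carrier R"
  using R.add.m_closed by simp

lemma carrier_diff: "p \<in> carrier R \<Longrightarrow> q \<in> carrier R \<Longrightarrow> p - q \<in> carrier R"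
  using carrier_add[of p "- q"] carrier_uminus by simp

lemma carrier_mult: "p \<in> carrier R \<Longrightarrow> q \<in> carrier R \<Longrightarrow> p * q \<in> carrier R"
  using R.m_closed by simp

lemma carrier_one: "1 \<in> carrier R"
  using R.one_closed by simp

lemma carrier_of_int: "of_int c \<in> carrier R"
  unfolding single_of_int[symmetric] carrier_R by simp

lemma carrier_flat_var: "F \<in> \<P> \<Longrightarrow> flat_var F \<in> carrier R"
  by (simp add: carrier_R flat_var_def)

lemma carrier_prod: "(\<And>x. x \<in> A \<Longrightarrow> f x \<in> carrier R) \<Longrightarrow> prod f A \<in> carrier R"
  by (induction A rule: infinite_finite_induct) (auto intro: carrier_one carrier_mult)

lemma R_finprod: "(\<And>x. x \<in> A \<Longrightarrow> f x \<in> carrier R) \<Longrightarrow> finprod R f A = prod f A"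
  by (induction A rule: infinite_finite_induct) (auto simp: Pi_def)

lemma R_finsum: "(\<And>x. x \<in> A \<Longrightarrow> f x \<in> carrier R) \<Longrightarrow> finsum R f A = sum f A"
  by (induction A rule: infinite_finite_induct) (auto simp: Pi_def)

lemmas carrier_intros = carrier_add carrier_diff carrier_mult carrier_one carrier_of_int
  carrier_flat_var carrier_prod

lemma K_relations_subset: "K_relations E indep \<subseteq> carrier R"
  by (auto simp: K_relations_def intro!: carrier_intros)

lemma ideal_I: "ideal I R"
  unfolding K_ideal_def by (rule R.genideal_ideal[OF K_relations_subset])

lemma relation_in_I: "p \<in> K_relations E indep \<Longrightarrow> p \<in> I"
  using R.genideal_self[OF K_relations_subset] by (auto simp: K_ideal_def)

interpretation I: ideal I R
  by (rule ideal_I)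

lemma I_add: "p \<in> I \<Longrightarrow> q \<in> I \<Longrightarrow> p + q \<in> I"
  using I.a_closed by simp

lemma I_mult: "p \<in> I \<Longrightarrow> r \<in> carrier R \<Longrightarrow> r * p \<in> I"
  using I.I_l_closed by simp

lemma I_zero: "0 \<in> I"
  using additive_subgroup.zero_closed[OF I.is_additive_subgroup] by simp

lemma I_diff: "p \<in> I \<Longrightarrow> q \<in> I \<Longrightarrow> p - q \<in> I"
  using I_add[of p "- q"] I_mult[of q "-1"] carrier_uminus[OF carrier_one] by simp

lemma I_sum: "(\<And>x. x \<in> A \<Longrightarrow> f x \<in> I) \<Longrightarrow> sum f A \<in> I"
  by (induction A rule: infinite_finite_induct) (auto intro: I_add I_zero)

interpretation quot: ring_hom_cring R K "a_r_coset R I"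
  unfolding K_ring_def by (rule I.rcos_ring_hom_cring[OF R.is_cring])

lemma coset_eq_zero_iff: "p \<in> carrier R \<Longrightarrow> I +>\<^bsub>R\<^esub> p = \<zero>\<^bsub>K\<^esub> \<longleftrightarrow> p \<in> I"
  using I.rcos_const_imp_mem[of p] R.a_rcos_zero[OF ideal_I, of p]
  by (auto simp: K_ring_def FactRing_def)

lemma coset_add_pow:
  fixes c :: int
  assumes p: "p \<in> carrier R"
  shows "[c] \<cdot>\<^bsub>K\<^esub> (I +>\<^bsub>R\<^esub> p) = I +>\<^bsub>R\<^esub> (of_int c * p)"
proof -
  have nat: "[n] \<cdot>\<^bsub>K\<^esub> (I +>\<^bsub>R\<^esub> p) = I +>\<^bsub>R\<^esub> (of_int (int n) * p)" for n :: nat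
  proof (induction n)
    case 0
    then show ?case using quot.hom_zero by simp
  next
    case (Suc n)
    have "of_int (int n) * p \<in> carrier R" using p by (intro carrier_intros)
    then show ?case
      using Suc p quot.hom_add[of "of_int (int n) * p" p] by (simp add: algebra_simps)
  qed
  show ?thesis
  proof (cases "c \<ge> 0")
    case True
    then show ?thesis using nat[of "nat c"] by (simp add: add_pow_int_ge)
  next
    case False
    have cp: "of_int c * p \<in> carrier R" "of_int (- c) * p \<in> carrier R"
      by (rule carrier_mult[OF carrier_of_int p])+
    have "\<ominus>\<^bsub>K\<^esub> (I +>\<^bsub>R\<^esub> (of_int (- c) * p)) = I +>\<^bsub>R\<^esub> (of_int c * p)"
      using quot.hom_add[OF cp] quot.hom_closed[OF cp(1)] quot.hom_closed[OF cp(2)] quot.hom_zero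
      by (intro quot.S.minus_equality) (simp_all flip: distrib_right of_int_add)
    then show ?thesis using False nat[of "nat (- c)"] by (simp add: add_pow_int_lt)
  qed
qed

definition flat_monomial :: "'a set set \<Rightarrow> 'a set_mpoly" where
  "flat_monomial \<F> = (\<Prod>F\<in>\<F>. flat_var F)"

lemma carrier_flat_monomial: "\<F> \<subseteq> \<P> \<Longrightarrow> flat_monomial \<F> \<in> carrier R"
  unfolding flat_monomial_def by (intro carrier_intros) blast

lemma K_flag_eq: "\<F> \<subseteq> \<P> \<Longrightarrow> K_flag E indep \<F> = I +>\<^bsub>R\<^esub> flat_monomial \<F>"
  using quot.hom_finprod[of flat_var \<F>] R_finprod[of \<F> flat_var] carrier_flat_var
  by (auto simp: K_flag_def K_gen_def flat_monomial_def o_def Pi_def subset_iff)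

lemma K_combination_eq_zero_iff:
  "(\<Oplus>\<^bsub>K\<^esub>\<F>\<in>\<L>. [c \<F>] \<cdot>\<^bsub>K\<^esub> K_flag E indep \<F>) = \<zero>\<^bsub>K\<^esub> \<longleftrightarrow>
   (\<Sum>\<F>\<in>\<L>. of_int (c \<F>) * flat_monomial \<F>) \<in> I" for c :: "'a set set \<Rightarrow> int"
proof -
  let ?f = "\<lambda>\<F>. of_int (c \<F>) * flat_monomial \<F>"
  have f: "?f \<F> \<in> carrier R" if "\<F> \<in> \<L>" for \<F>
    using flag_subset[OF that] by (intro carrier_intros carrier_flat_monomial)
  have "(\<Oplus>\<^bsub>K\<^esub>\<F>\<in>\<L>. [c \<F>] \<cdot>\<^bsub>K\<^esub> K_flag E indep \<F>) = (\<Oplus>\<^bsub>K\<^esub>\<F>\<in>\<L>. I +>\<^bsub>R\<^esub> ?f \<F>)"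
    using f quot.hom_closed flag_subset carrier_flat_monomial
    by (intro quot.S.finsum_cong') (auto simp: K_flag_eq coset_add_pow)
  also have "\<dots> = I +>\<^bsub>R\<^esub> (\<Sum>\<F>\<in>\<L>. ?f \<F>)"
    using quot.hom_finsum[of ?f \<L>] R_finsum[of \<L> ?f] f by (simp add: o_def Pi_def)
  finally show ?thesis
    using R.finsum_closed[of ?f \<L>] R_finsum[of \<L> ?f] f by (simp add: coset_eq_zero_iff Pi_def)
qed

text \<open>Linear relations in the quotient become membership in \<open>I\<close>, and the argument
  continues with polynomials modulo \<open>I\<close>.\<close>

lemma grothendieck_weight_iff:
  "grothendieck_weight E indep g \<longleftrightarrow>
    (\<forall>c :: 'a set set \<Rightarrow> int. (\<Sum>\<F>\<in>\<L>. of_int (c \<F>) * flat_monomial \<F>) \<in> I \<longrightarrow>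
      (\<Sum>\<F>\<in>\<L>. c \<F> * g \<F>) = 0)"
  by (simp add: grothendieck_weight_def K_combination_eq_zero_iff)

section \<open>Cancellation modulo the ideal and necessity of the equations\<close>

lemma flat_monomial_insert:
  "finite \<F> \<Longrightarrow> F \<notin> \<F> \<Longrightarrow> flat_monomial (insert F \<F>) = flat_var F * flat_monomial \<F>"
  by (simp add: flat_monomial_def)

lemma flat_monomial_in_I:
  assumes "\<F> \<subseteq> \<P>" "\<F> \<notin> \<L>"
  shows "flat_monomial \<F> \<in> I"
proof -
  obtain F G where FG: "F \<in> \<F>" "G \<in> \<F>" "\<not> F \<subseteq> G" "\<not> G \<subseteq> F"
    using assms by (auto simp: flags_def subset_chain_def)
  have fin: "finite \<F>" using assms(1) finite_proper_flats finite_subset by blast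
  have "flat_monomial \<F> = flat_var F * (flat_var G * flat_monomial (\<F> - {F} - {G}))"
    using FG fin unfolding flat_monomial_def
    by (subst prod.remove[of _ F], simp, simp, subst prod.remove[of _ G]) auto
  also have "\<dots> = flat_monomial (\<F> - {F} - {G}) * (flat_var F * flat_var G)"
    by (simp add: ac_simps)
  also have "\<dots> \<in> I"
    using assms(1) FG
    by (intro I_mult relation_in_I carrier_flat_monomial) (auto simp: K_relations_def)
  finally show ?thesis .
qed

lemma avoiding_relation:
  "i \<in> E \<Longrightarrow> j \<in> E \<Longrightarrow>
    (\<Prod>F\<in>{F \<in> \<P>. i \<notin> F}. 1 - flat_var F) - (\<Prod>F\<in>{F \<in> \<P>. j \<notin> F}. 1 - flat_var F) \<in> I"
  by (rule relation_in_I) (auto simp: K_relations_def)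

text \<open>Single-factor cancellation is assumed for all f, because the factors not yet cancelled
  are absorbed into f.\<close>

lemma cancel_prod:
  assumes "finite X" "X \<subseteq> \<P>"
    and cancel: "\<And>f F. f \<in> carrier R \<Longrightarrow> F \<in> X \<Longrightarrow> y * f * (1 - flat_var F) \<in> I \<Longrightarrow> y * f \<in> I"
    and "f \<in> carrier R" "y * f * (\<Prod>F\<in>X. 1 - flat_var F) \<in> I"
  shows "y * f \<in> I"
  using assms
proof (induction X rule: finite_induct)
  case (insert F X)
  let ?q = "\<Prod>F\<in>X. 1 - flat_var F"
  have "f * ?q \<in> carrier R"
    using insert.prems by (intro carrier_intros) auto
  moreover have "y * (f * ?q) * (1 - flat_var F) \<in> I"
    using insert.prems(4) insert.hyps by (simp add: ac_simps)
  ultimately have "y * (f * ?q) \<in> I"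
    using insert.prems(2) by blast
  then have "y * f * ?q \<in> I" by (simp add: ac_simps)
  moreover have "X \<subseteq> \<P>" using insert.prems(1) by blast
  ultimately show ?case
    using insert.IH insert.prems(2,3) by blast
qed simp

text \<open>No inverse of \<open>1 - x\<^sub>F\<close> is needed: for \<open>F \<in> \<F>\<close> one trades the factors avoiding \<open>i \<notin> F\<close> for
  those avoiding some \<open>j \<in> F\<close>, and the latter either lie below \<open>F\<close> or outside \<open>\<F>\<close>.\<close>

lemma cancel_factor:
  assumes "\<F> \<in> \<L>" "f \<in> carrier R" "F \<in> \<P>"
    and "flat_monomial \<F> * f * (1 - flat_var F) \<in> I"
  shows "flat_monomial \<F> * f \<in> I"
  using assms
proof (induction "card \<P> - card \<F>" arbitrary: \<F> f F rule: less_induct)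
  case (less \<F> f F)
  let ?x = "flat_monomial \<F>"
  have fin: "finite \<F>" and sub: "\<F> \<subseteq> \<P>"
    using finite_flag flag_subset less.prems(1) by auto
  \<comment> \<open>Multiplying by \<open>flat_var F\<close> gives the same situation for the larger
    set \<open>insert F \<F>\<close>, where cancellation holds by induction or the monomial lies in
    \<open>I\<close>. Then ?x * f is recovered as ?x * f * (1 - x) + x * ?x * f with x =
    \<open>flat_var F\<close>.\<close>
  have outside: "?x * f \<in> I"
    if f: "f \<in> carrier R" and F: "F \<in> \<P>" "F \<notin> \<F>" and I: "?x * f * (1 - flat_var F) \<in> I" for f F
  proof -
    have mono: "flat_monomial (insert F \<F>) = flat_var F * ?x"
      using fin F(2) by (rule flat_monomial_insert)
    have "flat_monomial (insert F \<F>) * f \<in> I"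
    proof (cases "insert F \<F> \<in> \<L>")
      case True
      have "card (insert F \<F>) \<le> card \<P>"
        using F(1) sub by (intro card_mono finite_proper_flats) blast
      then have "card \<P> - card (insert F \<F>) < card \<P> - card \<F>"
        using fin F(2) by simp
      moreover have "flat_monomial (insert F \<F>) * f * (1 - flat_var F) =
          flat_var F * (?x * f * (1 - flat_var F))"
        by (simp only: mono ac_simps)
      ultimately show ?thesis
        using less.hyps[OF _ True f F(1)] I_mult[OF I carrier_flat_var[OF F(1)]] by simp
    next
      case False
      then have "flat_monomial (insert F \<F>) \<in> I"
        using F(1) sub by (intro flat_monomial_in_I) auto
      then show ?thesis using I_mult f by (metis mult.commute)
    qed
    then have "?x * f * (1 - flat_var F) + flat_monomial (insert F \<F>) * f \<in> I"
      using I by (intro I_add)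
    then show ?thesis by (simp add: mono algebra_simps)
  qed
  have inside: "?x * f \<in> I"
    if "F \<in> \<F>" "f \<in> carrier R" "?x * f * (1 - flat_var F) \<in> I" for f F
    using that
  proof (induction "card F" arbitrary: F f rule: less_induct)
    case (less F f)
    obtain i j where ij: "i \<in> E - F" "j \<in> F" "neutral i j (\<F> - {F})"
      using flag_separation \<open>\<F> \<in> \<L>\<close> less.prems(1) by metis
    have FP: "F \<in> \<P>" using less.prems(1) sub by blast
    have FE: "F \<subset> E" using FP by (rule proper_flat_subset)
    let ?A = "\<lambda>i. {G \<in> \<P>. i \<notin> G}"
    let ?q = "\<lambda>X. \<Prod>G\<in>X. 1 - flat_var G"
    have carr: "?q X \<in> carrier R" if "X \<subseteq> \<P>" for X
      using that by (intro carrier_intros) auto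
    \<comment> \<open>The factor \<open>1 - flat_var F\<close> is completed to
      \<open>P\<^sub>i\<close>, which is exchanged for \<open>P\<^sub>j\<close> modulo
      \<open>I\<close>; the factors of \<open>P\<^sub>j\<close> are then cancelled singly.\<close>
    have "?q (?A i) = (1 - flat_var F) * ?q (?A i - {F})"
      using FP ij(1) finite_proper_flats by (intro prod.remove) auto
    then have "?x * f * ?q (?A i) = ?q (?A i - {F}) * (?x * f * (1 - flat_var F))"
      by (simp only: ac_simps)
    moreover have "?A i - {F} \<subseteq> \<P>" by blast
    ultimately have "?x * f * ?q (?A i) \<in> I"
      using I_mult[OF less.prems(3) carr] by simp
    moreover have "?x * f * (?q (?A i) - ?q (?A j)) \<in> I"
      using ij FE less.prems(2) sub
      by (intro I_mult avoiding_relation carrier_mult carrier_flat_monomial) auto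
    ultimately have "?x * f * ?q (?A i) - ?x * f * (?q (?A i) - ?q (?A j)) \<in> I"
      by (rule I_diff)
    then have "?x * f * ?q (?A j) \<in> I" by (simp add: algebra_simps)
    moreover have "?x * f \<in> I"
      if f: "f \<in> carrier R" and G: "G \<in> ?A j" and I: "?x * f * (1 - flat_var G) \<in> I" for f G
    proof (cases "G \<in> \<F>")
      case True
      then have "G \<subset> F"
        using flag_comparable[OF \<open>\<F> \<in> \<L>\<close> less.prems(1) True] G ij(2) by blast
      then have "card G < card F"
        using FE finite_ground by (intro psubset_card_mono) (auto intro: finite_subset)
      then show ?thesis using less.hyps[OF _ True f I] by blast
    next
      case False
      then show ?thesis using outside[OF f _ False I] G by blast
    qed
    ultimately show ?case
      using finite_proper_flats less.prems(2) by (intro cancel_prod[of "?A j" ?x f]) auto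
  qed
  show ?case
    using inside[OF _ less.prems(2,4)] outside[OF less.prems(2,3) _ less.prems(4)] by blast
qed

text \<open>The product expands over all subsets of separating flats; terms whose index set is not a
  flag lie in \<open>I\<close>. The auxiliary y replaces them by 0, as the conversion to refinements
  demands.\<close>

lemma flag_expansion:
  assumes \<G>: "\<G> \<in> \<L>" and neutral: "neutral i j \<G>"
  shows "flat_monomial \<G> * (\<Prod>F\<in>separating_flats i j. 1 - flat_var F) -
    (flat_monomial \<G> + (-1) ^ card \<G> *
      (\<Sum>\<F>\<in>refinements E indep i j \<G>. (-1) ^ card \<F> * flat_monomial \<F>)) \<in> I"
proof -
  let ?S = "separating_flats i j"
  define y where "y \<F> = (if \<F> \<in> \<L> then flat_monomial \<F> else 0)" for \<F>
  have "flat_monomial \<G> * (\<Prod>F\<in>?S. 1 - flat_var F) =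
      (\<Sum>\<T>\<in>Pow ?S. (-1) ^ card \<T> * flat_monomial (\<G> \<union> \<T>))"
  proof -
    have "flat_monomial \<G> * ((-1) ^ card \<T> * (\<Prod>F\<in>\<T>. flat_var F) * 1) =
        (-1) ^ card \<T> * flat_monomial (\<G> \<union> \<T>)" if "\<T> \<subseteq> ?S" for \<T>
    proof -
      have "finite \<T>" "\<G> \<inter> \<T> = {}"
        using that finite_separating_flats finite_subset neutral_disjoint[OF neutral] by blast+
      then have "flat_monomial (\<G> \<union> \<T>) = flat_monomial \<G> * (\<Prod>F\<in>\<T>. flat_var F)"
        unfolding flat_monomial_def by (intro prod.union_disjoint finite_flag[OF \<G>])
      then show ?thesis by (simp add: ac_simps)
    qed
    then show ?thesis
      using finite_separating_flats by (simp add: prod_diff_conv_sum sum_distrib_left)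
  qed
  moreover have "(\<Sum>\<T>\<in>Pow ?S. (-1) ^ card \<T> * y (\<G> \<union> \<T>)) = y \<G> + (-1) ^ card \<G> *
      (\<Sum>\<F>\<in>refinements E indep i j \<G>. (-1) ^ card \<F> * y \<F>)"
    by (rule sum_subsets_eq_refinements[OF assms]) (simp add: y_def)
  moreover have "(\<Sum>\<F>\<in>refinements E indep i j \<G>. (-1) ^ card \<F> * y \<F>) =
      (\<Sum>\<F>\<in>refinements E indep i j \<G>. (-1) ^ card \<F> * flat_monomial \<F>)"
    by (intro sum.cong) (auto simp: y_def refinements_def)
  moreover have "(\<Sum>\<T>\<in>Pow ?S. (-1) ^ card \<T> * flat_monomial (\<G> \<union> \<T>)) -
      (\<Sum>\<T>\<in>Pow ?S. (-1) ^ card \<T> * y (\<G> \<union> \<T>)) \<in> I"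
    unfolding sum_subtractf[symmetric]
  proof (rule I_sum)
    fix \<T> assume "\<T> \<in> Pow ?S"
    then have "\<G> \<union> \<T> \<subseteq> \<P>"
      using flag_subset[OF \<G>] by (auto simp: separating_flats_def)
    then have "flat_monomial (\<G> \<union> \<T>) - y (\<G> \<union> \<T>) \<in> I"
      using flat_monomial_in_I I_zero by (simp add: y_def)
    moreover have "(-1) ^ card \<T> \<in> carrier R"
      using carrier_of_int[of "(-1) ^ card \<T>"] by simp
    ultimately show "(-1) ^ card \<T> * flat_monomial (\<G> \<union> \<T>) - (-1) ^ card \<T> * y (\<G> \<union> \<T>) \<in> I"
      by (simp only: right_diff_distrib[symmetric] I_mult)
  qed
  ultimately show ?thesis using \<G> by (simp add: y_def)
qed

text \<open>Of \<open>P\<^sub>i\<close> and \<open>P\<^sub>j\<close>, the common factors are those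
  indexed by N. After their cancellation from the multiple of the relation by
  \<open>flat_monomial \<G>\<close>, both remaining products are expanded, and the terms
  \<open>flat_monomial \<G>\<close> cancel.\<close>

lemma refinement_relation:
  assumes i: "i \<in> E" and j: "j \<in> E" and \<G>: "\<G> \<in> \<L>" and neutral: "neutral i j \<G>"
  shows "(\<Sum>\<F>\<in>refinements E indep i j \<G>. (-1) ^ card \<F> * flat_monomial \<F>) -
    (\<Sum>\<F>\<in>refinements E indep j i \<G>. (-1) ^ card \<F> * flat_monomial \<F>) \<in> I"
proof -
  let ?x = "flat_monomial \<G>"
  let ?q = "\<lambda>X. \<Prod>G\<in>X. 1 - flat_var G"
  let ?S = separating_flats
  define N where "N = {F \<in> \<P>. i \<notin> F \<and> j \<notin> F}"
  have carr: "?q X \<in> carrier R" if "X \<subseteq> \<P>" for X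
    using that by (intro carrier_intros) auto
  have S: "?S i j \<subseteq> \<P>" "?S j i \<subseteq> \<P>" by (auto simp: separating_flats_def)
  have finN: "finite N" using finite_proper_flats by (simp add: N_def)
  have split_i: "{F \<in> \<P>. i \<notin> F} = N \<union> ?S j i" and split_j: "{F \<in> \<P>. j \<notin> F} = N \<union> ?S i j"
    by (auto simp: N_def separating_flats_def)
  have "?q (N \<union> ?S j i) = ?q N * ?q (?S j i)" "?q (N \<union> ?S i j) = ?q N * ?q (?S i j)"
    by (auto intro!: prod.union_disjoint simp: N_def separating_flats_def finite_proper_flats)
  moreover have "?x * (?q {F \<in> \<P>. j \<notin> F} - ?q {F \<in> \<P>. i \<notin> F}) \<in> I"
    using flag_subset[OF \<G>] by (intro I_mult avoiding_relation carrier_flat_monomial i j)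
  ultimately have rel: "?x * (?q (?S i j) - ?q (?S j i)) * ?q N \<in> I"
    unfolding split_i split_j by (simp add: algebra_simps)
  have cancel: "?x * f \<in> I"
    if "f \<in> carrier R" "F \<in> N" "?x * f * (1 - flat_var F) \<in> I" for f F
    using cancel_factor[OF \<G> that(1) _ that(3)] that(2) by (simp add: N_def)
  have "N \<subseteq> \<P>" by (auto simp: N_def)
  then have diff: "?x * (?q (?S i j) - ?q (?S j i)) \<in> I"
    by (rule cancel_prod[OF finN _ cancel carrier_diff[OF carr[OF S(1)] carr[OF S(2)]] rel])
  let ?\<Sigma> = "\<lambda>i j. \<Sum>\<F>\<in>refinements E indep i j \<G>. (-1) ^ card \<F> * flat_monomial \<F>"
  have neutral': "neutral j i \<G>" using neutral neutral_sym by metis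
  have "?x * (?q (?S i j) - ?q (?S j i)) -
      ((?x * ?q (?S i j) - (?x + (-1) ^ card \<G> * ?\<Sigma> i j)) -
       (?x * ?q (?S j i) - (?x + (-1) ^ card \<G> * ?\<Sigma> j i))) \<in> I"
    by (intro I_diff[OF diff] I_diff flag_expansion \<G> neutral neutral')
  then have "(-1) ^ card \<G> * (?\<Sigma> i j - ?\<Sigma> j i) \<in> I"
    by (simp add: algebra_simps)
  moreover have "(-1) ^ card \<G> \<in> carrier R"
    using carrier_of_int[of "(-1) ^ card \<G>"] by simp
  ultimately have "(-1) ^ card \<G> * ((-1) ^ card \<G> * (?\<Sigma> i j - ?\<Sigma> j i)) \<in> I"
    by (rule I_mult)
  then show ?thesis by (simp flip: mult.assoc power_mult_distrib)
qed

lemma grothendieck_weight_imp_balanced: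
  assumes "grothendieck_weight E indep g"
  shows "balanced g"
  unfolding balanced_def
proof (intro ballI impI)
  fix i j \<G> assume *: "i \<in> E" "j \<in> E" "\<G> \<in> \<L>" "neutral i j \<G>"
  define c :: "'a set set \<Rightarrow> int" where
    "c \<F> = (if \<F> \<in> refinements E indep i j \<G> then (-1) ^ card \<F> else 0) -
      (if \<F> \<in> refinements E indep j i \<G> then (-1) ^ card \<F> else 0)" for \<F>
  \<comment> \<open>Applied to flag monomials, this identifies c as the coefficients of a relation;
    applied to g, it yields the equation sought.\<close>
  have sum_c: "(\<Sum>\<F>\<in>\<L>. of_int (c \<F>) * f \<F>) =
      (\<Sum>\<F>\<in>refinements E indep i j \<G>. (-1) ^ card \<F> * f \<F>) -
      (\<Sum>\<F>\<in>refinements E indep j i \<G>. (-1) ^ card \<F> * f \<F>)" for f :: "_ \<Rightarrow> 'b::comm_ring_1"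
  proof -
    have "(\<Sum>\<F>\<in>\<L>. of_int (if \<F> \<in> refinements E indep i j \<G> then (-1) ^ card \<F> else 0) * f \<F>) =
        (\<Sum>\<F>\<in>refinements E indep i j \<G>. (-1) ^ card \<F> * f \<F>)" for i j
      using finite_flags by (intro sum.mono_neutral_cong_right) (auto simp: refinements_def)
    then show ?thesis
      by (simp add: c_def left_diff_distrib sum_subtractf)
  qed
  have "(\<Sum>\<F>\<in>\<L>. c \<F> * g \<F>) = 0"
    using assms refinement_relation[OF *] by (simp add: grothendieck_weight_iff sum_c)
  then show "(\<Sum>\<F>\<in>refinements E indep i j \<G>. (-1) ^ card \<F> * g \<F>) =
      (\<Sum>\<F>\<in>refinements E indep j i \<G>. (-1) ^ card \<F> * g \<F>)"
    using sum_c[of g] by simp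
qed

end

section \<open>The linear form of a balanced function\<close>

text \<open>Both sides are biadditive in p and q, so it suffices to compare them on
  generators.\<close>

lemma frag_extend_mult:
  fixes f :: "'b::comm_monoid_add \<Rightarrow> 'c::comm_monoid_add \<Rightarrow>\<^sub>0 int"
  assumes "\<And>a b. f (a + b) = f a * f b"
  shows "frag_extend f (p * q) = frag_extend f p * frag_extend f q"
  using subset_UNIV[of "Poly_Mapping.keys p"]
proof (induction p rule: frag_induction)
  case (one a)
  show ?case
    using subset_UNIV[of "Poly_Mapping.keys q"]
    by (induction q rule: frag_induction)
      (simp_all add: mult_single assms frag_extend_diff right_diff_distrib)
qed (simp_all add: frag_extend_diff left_diff_distrib)

lemma of_int_mult_eq_frag_cmul:
  fixes p :: "'b::monoid_add \<Rightarrow>\<^sub>0 int"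
  shows "of_int c * p = frag_cmul c p"
proof -
  have "of_int c * p = Poly_Mapping.single 0 c * p"
    by (simp flip: single_of_int)
  also have "\<dots> = Poly_Mapping.map ((*) c) p"
    by (rule mult_map_scale_conv_mult[symmetric])
  also have "\<dots> = frag_cmul c p"
    by (rule poly_mapping_eqI) (simp add: Poly_Mapping.map.rep_eq when_def)
  finally show ?thesis .
qed

section \<open>The substitution, the linear form and its vanishing on the ideal\<close>

context matroid
begin

text \<open>The substitution \<open>x\<^sub>F \<mapsto> 1 - t\<^sub>F\<close> into the Laurent polynomial ring, seen as the group ring of the
  lattice of exponents.\<close>

definition shift_subst :: "'a set_mpoly \<Rightarrow> ('a set \<Rightarrow>\<^sub>0 int) \<Rightarrow>\<^sub>0 int" where
  "shift_subst = frag_extend (\<lambda>m. \<Prod>F\<in>\<P>. (1 - frag_of (frag_of F)) ^ Poly_Mapping.lookup m F)"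

lemma shift_subst_diff: "shift_subst (p - q) = shift_subst p - shift_subst q"
  by (simp add: shift_subst_def frag_extend_diff)

lemma shift_subst_mult: "shift_subst (p * q) = shift_subst p * shift_subst q"
  unfolding shift_subst_def
  by (rule frag_extend_mult) (simp add: lookup_add power_add prod.distrib)

lemma shift_subst_one: "shift_subst 1 = 1"
  using frag_extend_of[of "\<lambda>m. \<Prod>F\<in>\<P>. (1 - frag_of (frag_of F)) ^ Poly_Mapping.lookup m F" 0]
  by (simp add: shift_subst_def)

lemma shift_subst_flat_var: "F \<in> \<P> \<Longrightarrow> shift_subst (flat_var F) = 1 - frag_of (frag_of F)"
proof -
  assume F: "F \<in> \<P>"
  have "shift_subst (flat_var F) =
      (\<Prod>G\<in>\<P>. if G = F then 1 - frag_of (frag_of G) else 1)"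
    by (auto simp: shift_subst_def flat_var_def lookup_single when_def intro!: prod.cong)
  also have "\<dots> = 1 - frag_of (frag_of F)"
    using F finite_proper_flats by (simp add: prod.delta)
  finally show ?thesis .
qed

lemma shift_subst_prod: "shift_subst (\<Prod>x\<in>A. f x) = (\<Prod>x\<in>A. shift_subst (f x))"
  by (induction A rule: infinite_finite_induct) (simp_all add: shift_subst_one shift_subst_mult)

lemma prod_frag_of: "(\<Prod>x\<in>A. frag_of (f x)) = frag_of (\<Sum>x\<in>A. f x)"
  by (induction A rule: infinite_finite_induct) (simp_all add: mult_single)

text \<open>Each factor \<open>1 - x\<^sub>F\<close> becomes the group element
  \<open>t\<^sub>F\<close>, so the product becomes a single Laurent monomial.\<close>

lemma shift_subst_avoiding:
  "shift_subst (\<Prod>F\<in>{F \<in> \<P>. i \<notin> F}. 1 - flat_var F) = frag_of (avoiding_sum i)"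
  unfolding shift_subst_prod avoiding_sum_def prod_frag_of[symmetric]
  by (intro prod.cong) (simp_all add: shift_subst_diff shift_subst_one shift_subst_flat_var)

text \<open>The additive extension of u to the free abelian group on its domain. The integers are
  viewed as the free abelian group on \<open>()\<close> so that \<open>frag_extend\<close>
  applies.\<close>

definition evaluate :: "('b \<Rightarrow> int) \<Rightarrow> ('b \<Rightarrow>\<^sub>0 int) \<Rightarrow> int" where
  "evaluate u q = Poly_Mapping.lookup (frag_extend (\<lambda>a. frag_cmul (u a) (frag_of ())) q) ()"

lemma evaluate_diff: "evaluate u (p - q) = evaluate u p - evaluate u q"
  by (simp add: evaluate_def frag_extend_diff lookup_minus)

lemma evaluate_zero: "evaluate u 0 = 0"
  by (simp add: evaluate_def)

lemma evaluate_add: "evaluate u (p + q) = evaluate u p + evaluate u q"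
  by (simp add: evaluate_def frag_extend_add lookup_add)

lemma evaluate_frag_of: "evaluate u (frag_of a) = u a"
  by (simp add: evaluate_def)

text \<open>Each factor \<open>1 - t\<^sub>F\<close> takes a difference in direction F, which by
  coherence adds F to the index of h.\<close>

lemma evaluate_flat_monomial:
  assumes coh: "\<And>\<F>. coherent g h \<F> (h \<F>)" and "finite \<F>"
  shows "evaluate (h {}) ((\<Prod>F\<in>\<F>. 1 - frag_of (frag_of F)) * frag_of a) = h \<F> a"
  using \<open>finite \<F>\<close>
proof (induction \<F> arbitrary: a rule: finite_induct)
  case empty
  show ?case by (simp add: evaluate_frag_of)
next
  case (insert F \<F>)
  let ?q = "\<Prod>F\<in>\<F>. 1 - frag_of (frag_of F)"
  have "frag_of (a + frag_of F) = frag_of (frag_of F) * frag_of a"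
    by (simp add: mult_single add.commute)
  then have "(\<Prod>F\<in>insert F \<F>. 1 - frag_of (frag_of F)) * frag_of a =
      ?q * frag_of a - ?q * frag_of (a + frag_of F)"
    using insert.hyps by (simp add: algebra_simps)
  then have "evaluate (h {}) ((\<Prod>F\<in>insert F \<F>. 1 - frag_of (frag_of F)) * frag_of a) =
      h \<F> a - h \<F> (a + frag_of F)"
    by (simp add: evaluate_diff insert.IH)
  then show ?case
    using coherent_step[of g h, OF coh coh insert.hyps(2)] by simp
qed

lemma evaluate_K_ideal:
  assumes coh: "\<And>\<F>. coherent g h \<F> (h \<F>)" and p: "p \<in> I"
  shows "evaluate (h {}) (shift_subst p) = 0"
proof -
  \<comment> \<open>Quantifying over all Laurent multiples q makes ?J an ideal. Incomparable pairs
    lie in it because h is zero off the flags, the other relations because h {} is periodic.\<close>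
  let ?J = "{p \<in> carrier R. \<forall>q. evaluate (h {}) (shift_subst p * q) = 0}"
  have J: "p \<in> ?J"
    if "p \<in> carrier R" and "\<And>a. evaluate (h {}) (shift_subst p * frag_of a) = 0" for p
  proof -
    have "evaluate (h {}) (shift_subst p * q) = 0" for q
      using subset_UNIV[of "Poly_Mapping.keys q"]
      by (induction q rule: frag_induction)
        (simp_all add: that evaluate_diff evaluate_zero right_diff_distrib)
    with that show ?thesis by simp
  qed
  have "subgroup ?J (add_monoid R)"
  proof (rule R.add.subgroupI)
    show "?J \<noteq> {}"
      using J[of 0] R.zero_closed by (auto simp: shift_subst_def evaluate_zero)
    show "\<ominus>\<^bsub>R\<^esub> p \<in> ?J" if "p \<in> ?J" for p
    proof -
      have "\<ominus>\<^bsub>R\<^esub> p = 0 - p"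
        using that by (intro R.minus_equality) (auto simp: carrier_uminus)
      then show ?thesis
        using that by (simp add: shift_subst_def frag_extend_minus carrier_uminus evaluate_diff[of _ 0, simplified] evaluate_zero)
    qed
    show "p \<oplus>\<^bsub>R\<^esub> q \<in> ?J" if "p \<in> ?J" "q \<in> ?J" for p q
      using that by (simp add: carrier_add shift_subst_def frag_extend_add distrib_right evaluate_add)
  qed auto
  moreover have "p * q \<in> ?J" "q * p \<in> ?J" if "p \<in> ?J" "q \<in> carrier R" for p q
    using that by (simp_all add: carrier_mult shift_subst_mult mult.commute[of q] mult.assoc mult.commute[of "shift_subst q"])
  ultimately have "ideal ?J R"
    by (intro idealI R.ring_axioms) auto
  moreover have "K_relations E indep \<subseteq> ?J"
  proof
    fix p assume p: "p \<in> K_relations E indep"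
    have "evaluate (h {}) (shift_subst p * frag_of a) = 0" for a
      using p unfolding K_relations_def
    proof (elim UnE CollectE exE conjE)
      fix F G
      assume FG: "p = flat_var F * flat_var G" "F \<in> \<P>" "G \<in> \<P>" "\<not> F \<subseteq> G" "\<not> G \<subseteq> F"
      then have "F \<noteq> G" by auto
      then have "shift_subst p = (\<Prod>F\<in>{F, G}. 1 - frag_of (frag_of F))"
        using FG by (simp add: shift_subst_mult shift_subst_flat_var)
      moreover have "{F, G} \<notin> \<L>" using FG by (auto simp: flags_def subset_chain_def)
      ultimately show ?thesis
        using coherent_zero[of g h, OF coh] by (simp add: evaluate_flat_monomial[OF coh] del: prod.insert)
    next
      fix i j
      assume "p = (\<Prod>F\<in>{F \<in> \<P>. i \<notin> F}. 1 - flat_var F) - (\<Prod>F\<in>{F \<in> \<P>. j \<notin> F}. 1 - flat_var F)"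
        and ij: "i \<in> E" "j \<in> E"
      then have "shift_subst p * frag_of a = frag_of (a + avoiding_sum i) - frag_of (a + avoiding_sum j)"
        by (simp add: shift_subst_diff shift_subst_avoiding left_diff_distrib mult_single add.commute)
      then show ?thesis
        using coherent_periodic[of g h, OF coh ij] by (simp add: evaluate_diff evaluate_frag_of)
    qed
    then show "p \<in> ?J" using J p K_relations_subset by blast
  qed
  ultimately have "I \<subseteq> ?J"
    unfolding K_ideal_def by (rule R.genideal_minimal)
  then have "evaluate (h {}) (shift_subst p * 1) = 0" using p by blast
  then show ?thesis by simp
qed

text \<open>The form sending p to \<open>evaluate (h {}) (shift_subst p)\<close> is additive,
  vanishes on \<open>I\<close> and takes the value g \<F> at the monomial of each flag \<F>.\<close>

lemma balanced_imp_grothendieck_weight: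
  assumes "balanced g"
  shows "grothendieck_weight E indep g"
  unfolding grothendieck_weight_iff
proof (intro allI impI)
  fix c :: "'a set set \<Rightarrow> int"
  assume c: "(\<Sum>\<F>\<in>\<L>. of_int (c \<F>) * flat_monomial \<F>) \<in> I"
  obtain h where coh: "\<And>\<F>. coherent g h \<F> (h \<F>)"
    using ex_coherent[OF assms] by blast
  have mono: "evaluate (h {}) (shift_subst (flat_monomial \<F>)) = g \<F>" if "\<F> \<in> \<L>" for \<F>
  proof -
    have "shift_subst (flat_monomial \<F>) = (\<Prod>F\<in>\<F>. 1 - frag_of (frag_of F))"
      using flag_subset[OF that]
      by (auto simp: flat_monomial_def shift_subst_prod shift_subst_flat_var intro!: prod.cong)
    then show ?thesis
      using evaluate_flat_monomial[OF coh finite_flag[OF that], of 0] coherent_at_zero[of g h, OF coh] that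
      by simp
  qed
  have "evaluate (h {}) (shift_subst (\<Sum>\<F>\<in>X. of_int (c \<F>) * flat_monomial \<F>)) =
      (\<Sum>\<F>\<in>X. c \<F> * evaluate (h {}) (shift_subst (flat_monomial \<F>)))" if "finite X" for X
    using that
    by (induction X rule: finite_induct)
      (simp_all add: of_int_mult_eq_frag_cmul shift_subst_def evaluate_def frag_extend_add
        frag_extend_cmul lookup_add)
  then show "(\<Sum>\<F>\<in>\<L>. c \<F> * g \<F>) = 0"
    using evaluate_K_ideal[OF coh c] finite_flags by (simp add: mono)
qed

end

section \<open>The characterization of Grothendieck weights on the ground set [n]\<close>

theorem proposition1p4:
  fixes n :: nat and indep :: "nat set \<Rightarrow> bool" and g :: "nat set set \<Rightarrow> int"
  assumes "loopless_matroid {1..n} indep"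
  shows "grothendieck_weight {1..n} indep g \<longleftrightarrow>
    (\<forall>i\<in>{1..n}. \<forall>j\<in>{1..n}. i \<noteq> j \<longrightarrow>
      (\<forall>\<G>\<in>flags {1..n} indep. neutral i j \<G> \<longrightarrow>
        (\<Sum>\<F>\<in>refinements {1..n} indep i j \<G>. (-1) ^ card \<F> * g \<F>) =
        (\<Sum>\<F>\<in>refinements {1..n} indep j i \<G>. (-1) ^ card \<F> * g \<F>)))"
proof -
  interpret matroid "{1..n}" indep
    using assms by (rule loopless_matroid.axioms)
  have "grothendieck_weight {1..n} indep g \<longleftrightarrow> balanced g"
    using grothendieck_weight_imp_balanced balanced_imp_grothendieck_weight by blast
  also have "\<dots> \<longleftrightarrow> (\<forall>i\<in>{1..n}. \<forall>j\<in>{1..n}. i \<noteq> j \<longrightarrow>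
      (\<forall>\<G>\<in>flags {1..n} indep. neutral i j \<G> \<longrightarrow>
        (\<Sum>\<F>\<in>refinements {1..n} indep i j \<G>. (-1) ^ card \<F> * g \<F>) =
        (\<Sum>\<F>\<in>refinements {1..n} indep j i \<G>. (-1) ^ card \<F> * g \<F>)))"
    unfolding balanced_def
  proof (intro ball_cong refl)
    fix i j
    show "(\<forall>\<G>\<in>flags {1..n} indep. neutral i j \<G> \<longrightarrow>
        (\<Sum>\<F>\<in>refinements {1..n} indep i j \<G>. (-1) ^ card \<F> * g \<F>) =
        (\<Sum>\<F>\<in>refinements {1..n} indep j i \<G>. (-1) ^ card \<F> * g \<F>)) \<longleftrightarrow>
      (i \<noteq> j \<longrightarrow> (\<forall>\<G>\<in>flags {1..n} indep. neutral i j \<G> \<longrightarrow>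
        (\<Sum>\<F>\<in>refinements {1..n} indep i j \<G>. (-1) ^ card \<F> * g \<F>) =
        (\<Sum>\<F>\<in>refinements {1..n} indep j i \<G>. (-1) ^ card \<F> * g \<F>)))"
      \<comment> \<open>For i = j the two sums coincide, so the equations with i = j contained in
        \<open>balanced\<close> hold trivially.\<close>
      by (cases "i = j") (simp, simp only: not_False_eq_True simp_thms)
  qed
  finally show ?thesis .
qed

end
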